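(* Fix $0 < \alpha < 2$. Let $(X_1, Y_1), (X_2, Y_2), \ldots$ be a sequence of independent pairs of real-valued random variables (the pairs are independent of each other; within a pair, $X_i$ and $Y_i$ may be dependent) such that $Y_1, Y_2, \ldots$ are copies of an $\alpha$-stable random variable $Y$ (that is, each $Y_i$ has the same distribution as $Y$), and such that for all $b > 0$, $$\lim_{n\to\infty} \frac{1}{n} \sum_{i=1}^{n} \mathbb{E}\left\{|X_i - Y_i|^\alpha\, \mathbb{1}\left(|X_i - Y_i| > b\,n^{(2-\alpha)/(2\alpha)}\right)\right\} = 0.$$ Write $S_n = (X_1 + \cdots + X_n)/n^{1/\alpha}$. Then there exists a sequence of real constants $(c_n)$ such that $$\lim_{n\to\infty} d_\alpha(S_n - c_n, Y) = 0.$$ Moreover, when $\alpha \in (1,2)$, we may take $c_n = n^{-1/\alpha}\sum_{i=1}^{n} \mathbb{E}X_i - \mathbb{E}Y$.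
   Context: Mallows distance: for $r>0$ and real random variables $U, V$ with distributions $F_U, F_V$, $d_r(U,V) = \left(\inf \mathbb{E}|U' - V'|^r\right)^{1/r} \in [0,\infty]$, where the infimum is over all pairs $(U',V')$ of random variables on a common probability space with $U' \sim F_U$ and $V' \sim F_V$. It depends only on the marginal distributions of $U$ and $V$. Stable laws: for $0<\alpha<2$, a random variable $Y$ is $\alpha$-stable if there are a scale parameter $\sigma \ge 0$, a skewness parameter $\beta \in [-1,1]$ and a shift parameter $\mu \in \mathbb{R}$ such that, for all $t\in\mathbb{R}$, $\mathbb{E}e^{itY} = \exp\{-\sigma^\alpha|t|^\alpha(1 - i\beta\,\mathrm{sgn}(t)\tan(\pi\alpha/2)) + i\mu t\}$ if $\alpha \ne 1$, and $\mathbb{E}e^{itY} = \exp\{-\sigma|t|(1 + i\beta\frac{2}{\pi}\mathrm{sgn}(t)\log|t|) + i\mu t\}$ if $\alpha = 1$ (with the exponent read as $0$ at $t=0$). Strict stability is not assumed. For $\alpha\in(1,2)$, $\mathbb{E}Y=\mu$. $\mathbb{1}(A)$ denotes the indicator of the event $A$. *)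

theory Defs
  imports "HOL-Probability.Probability"
begin

text \<open>
  Extended nonnegative powers: \<open>powr\<close> is not available on \<open>ennreal\<close>. Only positive
  exponents \<open>p\<close> are used, so that \<open>\<infinity>\<close> is mapped to \<open>\<infinity>\<close> and \<open>0\<close> to \<open>0\<close>.
\<close>
definition ennreal_powr :: "ennreal \<Rightarrow> real \<Rightarrow> ennreal" where
  "ennreal_powr x p = (if x = \<infinity> then \<infinity> else ennreal (enn2real x powr p))"

text \<open>
  The costs of all couplings of two laws on the real line. HOL cannot quantify over the type
  of the common probability space; the type \<open>real \<times> real\<close> carries the joint law of every
  pair, so no coupling is lost (lemma \<open>coupling_cost_any_space\<close> below).
\<close>
definition coupling_costs :: "real \<Rightarrow> real measure \<Rightarrow> real measure \<Rightarrow> ennreal set" where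
  "coupling_costs r F G =
     {\<integral>\<^sup>+\<omega>. ennreal (\<bar>U \<omega> - V \<omega>\<bar> powr r) \<partial>\<Omega> | (\<Omega> :: (real \<times> real) measure) U V.
        prob_space \<Omega> \<and> U \<in> borel_measurable \<Omega> \<and> V \<in> borel_measurable \<Omega> \<and>
        distr \<Omega> borel U = F \<and> distr \<Omega> borel V = G}"

definition mallows_dist :: "real \<Rightarrow> real measure \<Rightarrow> real measure \<Rightarrow> ennreal" where
  "mallows_dist r F G = ennreal_powr (Inf (coupling_costs r F G)) (1 / r)"

lemma coupling_cost_any_space:
  fixes \<Omega> :: "'c measure" and U V :: "'c \<Rightarrow> real"
  assumes "prob_space \<Omega>" and [measurable]: "U \<in> borel_measurable \<Omega>" "V \<in> borel_measurable \<Omega>"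
  shows "(\<integral>\<^sup>+\<omega>. ennreal (\<bar>U \<omega> - V \<omega>\<bar> powr r) \<partial>\<Omega>)
           \<in> coupling_costs r (distr \<Omega> borel U) (distr \<Omega> borel V)"
proof -
  let ?P = "distr \<Omega> (borel \<Otimes>\<^sub>M borel) (\<lambda>\<omega>. (U \<omega>, V \<omega>))"
  have "prob_space ?P"
    using assms(1) by (rule prob_space.prob_space_distr) measurable
  moreover have "fst \<in> borel_measurable ?P" "snd \<in> borel_measurable ?P"
    by (simp_all add: measurable_distr_eq1)
  moreover have "distr ?P borel fst = distr \<Omega> borel U" "distr ?P borel snd = distr \<Omega> borel V"
    by (simp_all add: distr_distr comp_def)
  moreover have "(\<integral>\<^sup>+p. ennreal (\<bar>fst p - snd p\<bar> powr r) \<partial>?P)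
      = (\<integral>\<^sup>+\<omega>. ennreal (\<bar>U \<omega> - V \<omega>\<bar> powr r) \<partial>\<Omega>)"
    by (subst nn_integral_distr) simp_all
  ultimately show ?thesis
    unfolding coupling_costs_def mem_Collect_eq
    by (intro exI[of _ ?P] exI[of _ fst] exI[of _ snd]) simp
qed

text \<open>
  At \<open>t = 0\<close> both exponents vanish automatically, since \<open>0 powr \<alpha> = 0\<close> and \<open>sgn 0 = 0\<close>.
\<close>
definition stable_char :: "real \<Rightarrow> real \<Rightarrow> real \<Rightarrow> real \<Rightarrow> real \<Rightarrow> complex" where
  "stable_char \<alpha> \<sigma> \<beta> \<mu> t =
     (if \<alpha> \<noteq> 1 then
        exp (- complex_of_real (\<sigma> powr \<alpha> * \<bar>t\<bar> powr \<alpha>)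
               * (1 - \<i> * complex_of_real (\<beta> * sgn t * tan (pi * \<alpha> / 2)))
             + \<i> * complex_of_real (\<mu> * t))
      else
        exp (- complex_of_real (\<sigma> * \<bar>t\<bar>)
               * (1 + \<i> * complex_of_real (\<beta> * (2 / pi) * sgn t * ln \<bar>t\<bar>))
             + \<i> * complex_of_real (\<mu> * t)))"

definition stable_law :: "real \<Rightarrow> real measure \<Rightarrow> bool" where
  "stable_law \<alpha> F \<longleftrightarrow>
     (\<exists>\<sigma> \<beta> \<mu>. 0 \<le> \<sigma> \<and> - 1 \<le> \<beta> \<and> \<beta> \<le> 1 \<and> (\<forall>t. char F t = stable_char \<alpha> \<sigma> \<beta> \<mu> t))"

end

theory Submission
  imports Defs
begin

text \<open>
  Put \<open>D i = X i - Y i\<close> and \<open>N = n powr (1 / \<alpha>)\<close>. Stability says that the normalised sum of the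
  \<open>Y i\<close>, shifted by a suitable constant \<open>a n\<close>, has the same law as \<open>Y\<close> (\<open>stable_sum_distr\<close>). It lives
  on the same space as \<open>S n\<close>, so it provides a coupling, whose cost involves only the \<open>D i\<close>:
  whatever the constant \<open>m\<close>, the distance of \<open>S n - (a n + m)\<close> to \<open>Y\<close> is controlled by the moment of
  order \<open>\<alpha>\<close> of \<open>(\<Sum>i=1..n. D i) / N - m\<close>. The cost can thus be finite although the moment of order
  \<open>\<alpha>\<close> of a non-degenerate \<open>Y\<close> is infinite.

  To bound this moment, cut each \<open>D i\<close> at the level \<open>c = b * n powr ((2 - \<alpha>) / (2 * \<alpha>))\<close>. The level
  is such that the normalised sum of the small parts, once centred, has variance of order \<open>b\<^sup>2\<close>, and
  hence a moment of order \<open>\<alpha>\<close> comparable to \<open>b powr \<alpha>\<close> (\<open>small_jumps_bound\<close>). For the large parts,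
  the moment of the normalised sum is at most a constant times the average of the individual moments,
  which the Lindeberg condition sends to zero. If \<open>\<alpha> \<le> 1\<close> this is subadditivity of the power; if
  \<open>\<alpha> > 1\<close>, the large parts are centred too and it is the von Bahr--Esseen inequality
  (\<open>von_Bahr_Esseen\<close>). Let \<open>n\<close> tend to infinity and then \<open>b\<close> to zero.

  For \<open>\<alpha> > 1\<close> the constant \<open>m\<close> is the normalised sum of the expectations of the \<open>D i\<close>. To rewrite
  \<open>a n + m\<close> as stated one needs that \<open>Y\<close> is integrable, which is derived from the behaviour of its
  characteristic function at the origin (\<open>stable_law_integrable\<close>); then \<open>a n\<close> is found by comparing
  the means of two variables that have the law of \<open>Y\<close>.
\<close>

section \<open>Inequalities for powers of absolute values\<close>

text \<open>
  On the unit interval one has \<open>u \<le> u powr p\<close>, since \<open>p \<le> 1\<close>; apply this to the two fractions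
  \<open>x / (x + y)\<close> and \<open>y / (x + y)\<close>, which add up to \<open>1\<close>.
\<close>
lemma add_powr_le:
  fixes x y p :: real
  assumes "0 \<le> x" "0 \<le> y" "0 < p" "p \<le> 1"
  shows "(x + y) powr p \<le> x powr p + y powr p"
proof (cases "x + y = 0")
  case True
  then show ?thesis using assms by simp
next
  case False
  define s where "s = x + y"
  have s: "s > 0" using False assms by (simp add: s_def)
  have le: "u / s \<le> (u / s) powr p" if "0 \<le> u" "u \<le> s" for u
  proof -
    have "(u / s) powr 1 \<le> (u / s) powr p" if "u \<noteq> 0"
      using that \<open>0 \<le> u\<close> \<open>u \<le> s\<close> s assms by (intro powr_mono') auto
    then show ?thesis using \<open>0 \<le> u\<close> s by (cases "u = 0") auto
  qed
  have "1 = x / s + y / s" using s by (simp add: s_def add_divide_distrib [symmetric])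
  also have "\<dots> \<le> (x / s) powr p + (y / s) powr p"
    using assms by (intro add_mono le) (auto simp: s_def)
  also have "\<dots> = (x powr p + y powr p) / s powr p"
    using assms s by (simp add: powr_divide add_divide_distrib)
  finally show ?thesis using s by (simp add: s_def field_simps)
qed

lemma abs_sum_powr_le:
  fixes f :: "'i \<Rightarrow> real"
  assumes "0 < p" "p \<le> 1"
  shows "\<bar>\<Sum>i\<in>I. f i\<bar> powr p \<le> (\<Sum>i\<in>I. \<bar>f i\<bar> powr p)"
proof (induction I rule: infinite_finite_induct)
  case (insert i I)
  have "\<bar>\<Sum>i\<in>insert i I. f i\<bar> powr p \<le> (\<bar>f i\<bar> + \<bar>\<Sum>i\<in>I. f i\<bar>) powr p"
    using insert assms by (intro powr_mono2) auto
  also have "\<dots> \<le> \<bar>f i\<bar> powr p + \<bar>\<Sum>i\<in>I. f i\<bar> powr p"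
    using assms by (intro add_powr_le) auto
  finally show ?case using insert by simp
qed auto

lemma abs_add_powr_le:
  fixes a b p :: real
  assumes "0 < p" "p \<le> 2"
  shows "\<bar>a + b\<bar> powr p \<le> 4 * (\<bar>a\<bar> powr p + \<bar>b\<bar> powr p)"
proof -
  define m where "m = max \<bar>a\<bar> \<bar>b\<bar>"
  have "\<bar>a + b\<bar> powr p \<le> (2 * m) powr p"
    using assms by (intro powr_mono2) (auto simp: m_def)
  also have "\<dots> = 2 powr p * m powr p" by (simp add: powr_mult m_def)
  also have "\<dots> \<le> 2 powr 2 * m powr p"
    using assms by (intro mult_right_mono powr_mono) auto
  also have "\<dots> \<le> 4 * (\<bar>a\<bar> powr p + \<bar>b\<bar> powr p)"
    by (auto simp: m_def max_def)
  finally show ?thesis .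
qed

text \<open>
  A pointwise stand-in for Lyapunov's inequality: if \<open>x\<close> has second moment at most \<open>a\<^sup>2\<close>, taking
  expectations bounds its moment of order \<open>p\<close> by \<open>2 * a powr p\<close>.
\<close>
lemma abs_powr_le_square:
  fixes x a p :: real
  assumes "0 < a" "0 < p" "p \<le> 2"
  shows "\<bar>x\<bar> powr p \<le> a powr p + a powr (p - 2) * \<bar>x\<bar> powr 2"
proof (cases "\<bar>x\<bar> \<le> a")
  case True
  then have "\<bar>x\<bar> powr p \<le> a powr p" using assms by (intro powr_mono2) auto
  then show ?thesis by (simp add: add_increasing2)
next
  case False
  then have "\<bar>x\<bar> powr p = \<bar>x\<bar> powr (p - 2) * \<bar>x\<bar> powr 2"
    using assms by (simp flip: powr_add del: powr_numeral)
  also have "\<dots> \<le> a powr (p - 2) * \<bar>x\<bar> powr 2"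
    using False assms by (intro mult_right_mono powr_mono2') auto
  finally show ?thesis by (simp add: add_increasing)
qed

text \<open>
  Up to the factor \<open>q + 1\<close>, the derivative of \<open>\<bar>x\<bar> powr (q + 1)\<close>.
\<close>
definition signed_powr :: "real \<Rightarrow> real \<Rightarrow> real" where
  "signed_powr q x = sgn x * \<bar>x\<bar> powr q"

lemma signed_powr_measurable [measurable]: "signed_powr q \<in> borel_measurable borel"
  unfolding signed_powr_def[abs_def] by measurable

lemma abs_signed_powr [simp]: "\<bar>signed_powr q x\<bar> = \<bar>x\<bar> powr q"
  by (simp add: signed_powr_def abs_mult abs_sgn_eq)

text \<open>
  For arguments of equal sign the bound, with constant \<open>1\<close>, is subadditivity of the power; for
  opposite signs the two absolute values add up to \<open>\<bar>a - b\<bar>\<close>, and each of their powers is at most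
  \<open>\<bar>a - b\<bar> powr q\<close>.
\<close>
lemma signed_powr_holder:
  assumes "0 < q" "q \<le> 1"
  shows "\<bar>signed_powr q a - signed_powr q b\<bar> \<le> 2 * \<bar>a - b\<bar> powr q"
proof -
  have ge: "u powr q - v powr q \<le> (u - v) powr q" if "0 \<le> v" "v \<le> u" for u v :: real
    using add_powr_le[of v "u - v" q] that assms by simp
  have same: "\<bar>u powr q - v powr q\<bar> \<le> \<bar>u - v\<bar> powr q" if "0 \<le> u" "0 \<le> v" for u v :: real
  proof (cases "v \<le> u")
    case True
    then show ?thesis using ge[OF that(2) True] powr_mono2[of q v u] assms that by simp
  next
    case False
    then show ?thesis using ge[OF that(1)] powr_mono2[of q u v] assms that by simp
  qed
  have opp: "u powr q + v powr q \<le> 2 * (u + v) powr q" if "0 \<le> u" "0 \<le> v" for u v :: real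
    using powr_mono2[of q u "u + v"] powr_mono2[of q v "u + v"] that assms by simp
  have nonneg: "0 \<le> \<bar>a - b\<bar> powr q" by simp
  consider "0 \<le> a" "0 \<le> b" | "a \<le> 0" "b \<le> 0" | "0 \<le> a" "b \<le> 0" | "a \<le> 0" "0 \<le> b" by linarith
  then show ?thesis
  proof cases
    case 1
    then have "signed_powr q a = a powr q" "signed_powr q b = b powr q" by (auto simp: signed_powr_def sgn_if)
    then show ?thesis using same[OF 1] nonneg by linarith
  next
    case 2
    then have "signed_powr q a = - ((-a) powr q)" "signed_powr q b = - ((-b) powr q)" by (auto simp: signed_powr_def sgn_if)
    moreover have "\<bar>- a - - b\<bar> = \<bar>a - b\<bar>" by simp
    ultimately show ?thesis using same[of "-a" "-b"] 2 nonneg by (smt (verit))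
  next
    case 3
    then have "signed_powr q a = a powr q" "signed_powr q b = - ((-b) powr q)" by (auto simp: signed_powr_def sgn_if)
    then show ?thesis using opp[of a "-b"] 3 by simp
  next
    case 4
    then have "signed_powr q a = - ((-a) powr q)" "signed_powr q b = b powr q" by (auto simp: signed_powr_def sgn_if)
    then show ?thesis using opp[of "-a" b] 4 by (simp add: abs_minus_commute add.commute)
  qed
qed

text \<open>
  The convex function \<open>\<bar>x\<bar> powr p\<close> lies above its tangent at \<open>v\<close>. Multiplied out, this is Young's
  inequality for the product of \<open>\<bar>u\<bar>\<close> and \<open>\<bar>v\<bar> powr (p - 1)\<close>.
\<close>
lemma abs_powr_subgradient:
  fixes u v p :: real
  assumes "1 < p"
  shows "\<bar>v\<bar> powr p + p * signed_powr (p - 1) v * (u - v) \<le> \<bar>u\<bar> powr p"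
proof -
  have pw: "\<bar>v\<bar> powr (p - 1) * \<bar>v\<bar> = \<bar>v\<bar> powr p"
    by (cases "v = 0") (simp_all add: powr_diff)
  have "\<bar>u\<bar> * \<bar>v\<bar> powr (p - 1) \<le> \<bar>u\<bar> powr p / p + (\<bar>v\<bar> powr (p - 1)) powr (p / (p - 1)) / (p / (p - 1))"
    using assms by (intro Youngs_inequality) (auto simp: field_simps)
  also have "(\<bar>v\<bar> powr (p - 1)) powr (p / (p - 1)) = \<bar>v\<bar> powr p"
    using assms by (simp add: powr_powr)
  finally have young: "p * (\<bar>u\<bar> * \<bar>v\<bar> powr (p - 1)) \<le> \<bar>u\<bar> powr p + (p - 1) * \<bar>v\<bar> powr p"
    using assms by (simp add: field_simps)
  have "signed_powr (p - 1) v * v = \<bar>v\<bar> powr p"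
    unfolding pw[symmetric] by (simp add: signed_powr_def abs_sgn algebra_simps)
  moreover have "signed_powr (p - 1) v * u \<le> \<bar>u\<bar> * \<bar>v\<bar> powr (p - 1)"
    using abs_ge_self[of "signed_powr (p - 1) v * u"] by (simp add: abs_mult mult.commute)
  then have "p * (signed_powr (p - 1) v * u) \<le> p * (\<bar>u\<bar> * \<bar>v\<bar> powr (p - 1))"
    using assms by (intro mult_left_mono) auto
  ultimately show ?thesis using young by (simp add: algebra_simps)
qed

text \<open>
  A first-order Taylor expansion at \<open>x\<close> whose remainder does not depend on \<open>x\<close>. The tangent at
  \<open>x + y\<close> gives the same inequality with the slope taken at \<open>x + y\<close>, and Hoelder continuity of
  exponent \<open>p - 1\<close> allows the slope to be moved to \<open>x\<close> at a cost of order \<open>\<bar>y\<bar> powr p\<close>.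
\<close>
lemma abs_add_powr_expansion:
  fixes x y p :: real
  assumes "1 < p" "p \<le> 2"
  shows "\<bar>x + y\<bar> powr p \<le> \<bar>x\<bar> powr p + p * (signed_powr (p - 1) x * y) + 4 * \<bar>y\<bar> powr p"
proof -
  have pw: "\<bar>y\<bar> powr (p - 1) * \<bar>y\<bar> = \<bar>y\<bar> powr p"
    by (cases "y = 0") (simp_all add: powr_diff)
  have "(signed_powr (p - 1) (x + y) - signed_powr (p - 1) x) * y \<le> \<bar>signed_powr (p - 1) (x + y) - signed_powr (p - 1) x\<bar> * \<bar>y\<bar>"
    by (metis abs_ge_self abs_mult)
  also have "\<dots> \<le> (2 * \<bar>y\<bar> powr (p - 1)) * \<bar>y\<bar>"
    using signed_powr_holder[of "p - 1" "x + y" x] assms by (intro mult_right_mono) auto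
  finally have "(signed_powr (p - 1) (x + y) - signed_powr (p - 1) x) * y \<le> 2 * \<bar>y\<bar> powr p"
    using pw by simp
  then have "p * ((signed_powr (p - 1) (x + y) - signed_powr (p - 1) x) * y) \<le> p * (2 * \<bar>y\<bar> powr p)"
    using assms by (intro mult_left_mono) auto
  also have "\<dots> \<le> 2 * (2 * \<bar>y\<bar> powr p)"
    using assms by (intro mult_right_mono) auto
  finally show ?thesis
    using abs_powr_subgradient[OF assms(1), of "x + y" x] by (simp add: algebra_simps)
qed

lemma powr_le_one_add_powr:
  fixes x p q :: real
  assumes "0 \<le> x" "0 < q" "q \<le> p"
  shows "x powr q \<le> 1 + x powr p"
proof (cases "x \<le> 1")
  case True
  then have "x powr q \<le> 1" using assms by (intro powr_le1) auto
  then show ?thesis by (simp add: add_increasing2)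
next
  case False
  then have "x powr q \<le> x powr p" using assms by (intro powr_mono) auto
  then show ?thesis by simp
qed

section \<open>Moments of sums of independent centred variables\<close>

lemma (in prob_space) integrable_of_powr_integrable:
  fixes Z :: "'a \<Rightarrow> real"
  assumes [measurable]: "Z \<in> borel_measurable M"
    and "integrable M (\<lambda>\<omega>. \<bar>Z \<omega>\<bar> powr p)" "1 \<le> p"
  shows "integrable M Z"
proof (rule Bochner_Integration.integrable_bound)
  show "integrable M (\<lambda>\<omega>. 1 + \<bar>Z \<omega>\<bar> powr p)" using assms by simp
  show "AE \<omega> in M. norm (Z \<omega>) \<le> norm (1 + \<bar>Z \<omega>\<bar> powr p)"
    using powr_le_one_add_powr[of "\<bar>Z _\<bar>" 1 p] assms(3) by (auto simp: abs_of_nonneg)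
qed simp

lemma (in prob_space) integrable_abs_add_powr:
  fixes U V :: "'a \<Rightarrow> real"
  assumes [measurable]: "U \<in> borel_measurable M" "V \<in> borel_measurable M"
    and "integrable M (\<lambda>\<omega>. \<bar>U \<omega>\<bar> powr p)" "integrable M (\<lambda>\<omega>. \<bar>V \<omega>\<bar> powr p)" "0 < p" "p \<le> 2"
  shows "integrable M (\<lambda>\<omega>. \<bar>U \<omega> + V \<omega>\<bar> powr p)"
proof (rule Bochner_Integration.integrable_bound)
  show "integrable M (\<lambda>\<omega>. 4 * (\<bar>U \<omega>\<bar> powr p + \<bar>V \<omega>\<bar> powr p))" using assms by simp
  show "AE \<omega> in M. norm (\<bar>U \<omega> + V \<omega>\<bar> powr p) \<le> norm (4 * (\<bar>U \<omega>\<bar> powr p + \<bar>V \<omega>\<bar> powr p))"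
    using abs_add_powr_le[OF assms(5,6)] by (auto simp: abs_of_nonneg)
qed simp

text \<open>
  Jensen's inequality: integrate the tangent inequality at the mean, where the linear term
  disappears.
\<close>
lemma (in prob_space) abs_expectation_powr_le:
  fixes Z :: "'a \<Rightarrow> real"
  assumes [measurable]: "Z \<in> borel_measurable M"
    and Zp: "integrable M (\<lambda>\<omega>. \<bar>Z \<omega>\<bar> powr p)" and p: "1 < p"
  shows "\<bar>expectation Z\<bar> powr p \<le> expectation (\<lambda>\<omega>. \<bar>Z \<omega>\<bar> powr p)"
proof -
  let ?m = "expectation Z"
  have Z: "integrable M Z" using integrable_of_powr_integrable[OF _ Zp] p by simp
  have "expectation (\<lambda>\<omega>. \<bar>?m\<bar> powr p + p * signed_powr (p - 1) ?m * (Z \<omega> - ?m)) \<le> expectation (\<lambda>\<omega>. \<bar>Z \<omega>\<bar> powr p)"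
    using Z Zp abs_powr_subgradient[OF p] by (intro integral_mono) auto
  then show ?thesis using Z by (simp add: prob_space)
qed

text \<open>
  Add the summands one at a time. In the expansion of \<open>\<bar>S + Z i\<bar> powr p\<close> around the partial sum \<open>S\<close>,
  the linear term has mean zero, because \<open>S\<close> is independent of the centred variable \<open>Z i\<close>; so each
  step costs only \<open>4\<close> times the moment of the new summand. The case \<open>p = 2\<close> takes the place of the
  additivity of the variance.
\<close>
lemma (in prob_space) von_Bahr_Esseen:
  fixes Z :: "'i \<Rightarrow> 'a \<Rightarrow> real"
  assumes p: "1 < p" "p \<le> 2" and fin: "finite I"
    and indep: "indep_vars (\<lambda>_. borel) Z I"
    and int: "\<And>i. i \<in> I \<Longrightarrow> integrable M (\<lambda>\<omega>. \<bar>Z i \<omega>\<bar> powr p)"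
    and zero: "\<And>i. i \<in> I \<Longrightarrow> expectation (Z i) = 0"
  shows "integrable M (\<lambda>\<omega>. \<bar>\<Sum>i\<in>I. Z i \<omega>\<bar> powr p) \<and>
    expectation (\<lambda>\<omega>. \<bar>\<Sum>i\<in>I. Z i \<omega>\<bar> powr p) \<le> 4 * (\<Sum>i\<in>I. expectation (\<lambda>\<omega>. \<bar>Z i \<omega>\<bar> powr p))"
  using fin indep int zero
proof (induction I)
  case empty
  then show ?case by simp
next
  case (insert i I)
  define S where "S = (\<lambda>\<omega>. \<Sum>j\<in>I. Z j \<omega>)"
  have rv: "Z j \<in> borel_measurable M" if "j \<in> insert i I" for j
    using insert.prems(1) that by (auto simp: indep_vars_def)
  then have [measurable]: "Z i \<in> borel_measurable M" "S \<in> borel_measurable M"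
    by (auto simp: S_def)
  have IH: "integrable M (\<lambda>\<omega>. \<bar>S \<omega>\<bar> powr p)"
    "expectation (\<lambda>\<omega>. \<bar>S \<omega>\<bar> powr p) \<le> 4 * (\<Sum>i\<in>I. expectation (\<lambda>\<omega>. \<bar>Z i \<omega>\<bar> powr p))"
    using insert indep_vars_subset[OF insert.prems(1), of I] by (auto simp: S_def)
  have Zp: "integrable M (\<lambda>\<omega>. \<bar>Z i \<omega>\<bar> powr p)" using insert by simp
  have Z: "integrable M (Z i)" using integrable_of_powr_integrable[OF _ Zp] p by simp
  have signed_powr_int: "integrable M (\<lambda>\<omega>. signed_powr (p - 1) (S \<omega>))"
  proof (rule Bochner_Integration.integrable_bound)
    show "integrable M (\<lambda>\<omega>. 1 + \<bar>S \<omega>\<bar> powr p)" using IH by simp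
    show "AE \<omega> in M. norm (signed_powr (p - 1) (S \<omega>)) \<le> norm (1 + \<bar>S \<omega>\<bar> powr p)"
      using powr_le_one_add_powr[of "\<bar>S _\<bar>" "p - 1" p] p by (auto simp: abs_of_nonneg)
  qed measurable
  have "indep_var borel (Z i) borel S"
    unfolding S_def using insert by (intro indep_vars_sum) auto
  then have "indep_var borel (id \<circ> Z i) borel (signed_powr (p - 1) \<circ> S)"
    by (intro indep_var_compose) auto
  then have ind: "indep_var borel (Z i) borel (\<lambda>\<omega>. signed_powr (p - 1) (S \<omega>))"
    by (simp add: comp_def)
  have cross_int: "integrable M (\<lambda>\<omega>. signed_powr (p - 1) (S \<omega>) * Z i \<omega>)"
    using indep_var_integrable[OF ind Z signed_powr_int] by (simp add: mult.commute)
  (* Independence splits this expectation, and the second factor is centred. *)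
  have cross: "expectation (\<lambda>\<omega>. signed_powr (p - 1) (S \<omega>) * Z i \<omega>) = 0"
    using indep_var_lebesgue_integral[OF ind Z signed_powr_int] insert.prems(3) by (simp add: mult.commute)
  have SZ: "integrable M (\<lambda>\<omega>. \<bar>S \<omega> + Z i \<omega>\<bar> powr p)"
    using IH Zp p by (intro integrable_abs_add_powr) auto
  have "expectation (\<lambda>\<omega>. \<bar>S \<omega> + Z i \<omega>\<bar> powr p) \<le>
      expectation (\<lambda>\<omega>. \<bar>S \<omega>\<bar> powr p + p * (signed_powr (p - 1) (S \<omega>) * Z i \<omega>) + 4 * \<bar>Z i \<omega>\<bar> powr p)"
    using SZ IH cross_int Zp abs_add_powr_expansion[OF p] by (intro integral_mono) auto
  also have "\<dots> = expectation (\<lambda>\<omega>. \<bar>S \<omega>\<bar> powr p) + 4 * expectation (\<lambda>\<omega>. \<bar>Z i \<omega>\<bar> powr p)"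
    using IH cross_int Zp cross by simp
  finally have "expectation (\<lambda>\<omega>. \<bar>S \<omega> + Z i \<omega>\<bar> powr p) \<le>
      4 * (\<Sum>i\<in>insert i I. expectation (\<lambda>\<omega>. \<bar>Z i \<omega>\<bar> powr p))"
    using IH insert.hyps by simp
  with SZ show ?case using insert.hyps by (simp add: S_def add.commute)
qed

section \<open>Stable laws\<close>

text \<open>
  The term of order \<open>\<bar>t\<bar> powr \<alpha>\<close> in the exponent is exactly reproduced by the scaling, so only terms
  linear in \<open>t\<close> can change, and these amount to a shift. For \<open>\<alpha> \<noteq> 1\<close> the change comes from the shift
  parameter \<open>\<mu>\<close>; for \<open>\<alpha> = 1\<close> it comes from the logarithm, since \<open>ln \<bar>t / n\<bar> = ln \<bar>t\<bar> - ln n\<close>.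
\<close>
lemma stable_char_scaling:
  assumes alpha: "0 < \<alpha>" and n: "n \<ge> 1"
  shows "\<exists>a. \<forall>t. stable_char \<alpha> \<sigma> \<beta> \<mu> (t / real n powr (1 / \<alpha>)) ^ n = iexp (a * t) * stable_char \<alpha> \<sigma> \<beta> \<mu> t"
proof (cases "\<alpha> = 1")
  case False
  let ?N = "real n powr (1 / \<alpha>)"
  have N: "?N > 0" using n by simp
  have Na: "?N powr \<alpha> = real n" using alpha n by (simp add: powr_powr)
  show ?thesis
  proof (intro exI[of _ "real n * \<mu> / ?N - \<mu>"] allI)
    fix t
    have abs_t: "\<bar>t / ?N\<bar> powr \<alpha> = \<bar>t\<bar> powr \<alpha> / real n"
      using N Na by (simp add: powr_divide)
    have sgn_t: "sgn (t / ?N) = sgn t" using N by (simp add: sgn_if field_simps)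
    have n0: "complex_of_nat n \<noteq> 0" using n by simp
    show "stable_char \<alpha> \<sigma> \<beta> \<mu> (t / ?N) ^ n = iexp ((real n * \<mu> / ?N - \<mu>) * t) * stable_char \<alpha> \<sigma> \<beta> \<mu> t"
    proof -
      let ?z = "complex_of_real (\<sigma> powr \<alpha> * \<bar>t\<bar> powr \<alpha>)
               * (1 - \<i> * complex_of_real (\<beta> * sgn t * tan (pi * \<alpha> / 2)))"
      have "stable_char \<alpha> \<sigma> \<beta> \<mu> (t / ?N) =
          exp (- complex_of_real (\<sigma> powr \<alpha> * (\<bar>t\<bar> powr \<alpha> / real n))
               * (1 - \<i> * complex_of_real (\<beta> * sgn t * tan (pi * \<alpha> / 2)))
             + \<i> * complex_of_real (\<mu> * (t / ?N)))"
        using False unfolding stable_char_def abs_t sgn_t by simp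
      also have "\<dots> = exp (- (?z / of_nat n) + \<i> * complex_of_real (\<mu> * (t / ?N)))"
        by simp
      finally have "stable_char \<alpha> \<sigma> \<beta> \<mu> (t / ?N) ^ n =
          exp (of_nat n * (- (?z / of_nat n) + \<i> * complex_of_real (\<mu> * (t / ?N))))"
        by (simp only: exp_of_nat_mult)
      also have "of_nat n * (- (?z / of_nat n) + \<i> * complex_of_real (\<mu> * (t / ?N))) =
          \<i> * complex_of_real ((real n * \<mu> / ?N - \<mu>) * t) + (- ?z + \<i> * complex_of_real (\<mu> * t))"
      proof -
        have "of_nat n * (- (?z / of_nat n)) = - ?z" using n0 by simp
        moreover have "of_nat n * (\<i> * complex_of_real (\<mu> * (t / ?N))) =
            \<i> * complex_of_real ((real n * \<mu> / ?N - \<mu>) * t) + \<i> * complex_of_real (\<mu> * t)"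
          by (simp add: algebra_simps)
        ultimately show ?thesis by (simp only: distrib_left add_ac)
      qed
      finally show ?thesis using False by (simp add: stable_char_def exp_add)
    qed
  qed
next
  case True
  show ?thesis
  proof (intro exI[of _ "\<sigma> * \<beta> * (2 / pi) * ln (real n)"] allI)
    fix t
    define l where "l = \<beta> * (2 / pi) * sgn t * ln \<bar>t\<bar>"
    define l' where "l' = \<beta> * (2 / pi) * sgn (t / real n) * ln \<bar>t / real n\<bar>"
    let ?a = "\<sigma> * \<beta> * (2 / pi) * ln (real n)"
    have l': "\<bar>t\<bar> * l' = \<bar>t\<bar> * l - \<beta> * (2 / pi) * ln (real n) * t"
    proof (cases "t = 0")
      case False
      have "sgn (t / real n) = sgn t" using n by (simp add: sgn_if field_simps)
      moreover have "ln \<bar>t / real n\<bar> = ln \<bar>t\<bar> - ln (real n)" using n False by (simp add: ln_div)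
      ultimately have "\<bar>t\<bar> * l' = \<bar>t\<bar> * l - \<beta> * (2 / pi) * ln (real n) * (\<bar>t\<bar> * sgn t)"
        by (simp only: l'_def l_def) (simp only: right_diff_distrib mult_ac)
      then show ?thesis by (simp add: abs_mult_sgn)
    qed simp
    have n0: "real n \<noteq> 0" using n by simp
    have abs_t: "real n * \<bar>t / real n\<bar> = \<bar>t\<bar>" using n by simp
    have "real n * (- (\<sigma> * \<bar>t / real n\<bar>) * l' + \<mu> * (t / real n)) = - \<sigma> * ((real n * \<bar>t / real n\<bar>) * l') + \<mu> * t"
      using n0 by (simp add: algebra_simps)
    also have "\<dots> = ?a * t + (- (\<sigma> * \<bar>t\<bar>) * l + \<mu> * t)"
      unfolding abs_t l' by (simp add: algebra_simps)
    finally have Im: "real n * (- (\<sigma> * \<bar>t / real n\<bar>) * l' + \<mu> * (t / real n)) =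
      ?a * t + (- (\<sigma> * \<bar>t\<bar>) * l + \<mu> * t)" .
    have Re: "real n * - (\<sigma> * \<bar>t / real n\<bar>) = - (\<sigma> * \<bar>t\<bar>)" using n0 by simp
    have "of_nat n * (- complex_of_real (\<sigma> * \<bar>t / real n\<bar>) * (1 + \<i> * complex_of_real l')
           + \<i> * complex_of_real (\<mu> * (t / real n))) =
        \<i> * complex_of_real (?a * t) + (- complex_of_real (\<sigma> * \<bar>t\<bar>) * (1 + \<i> * complex_of_real l)
           + \<i> * complex_of_real (\<mu> * t))" (is "of_nat n * ?z = ?w")
    proof (rule complex_eqI)
      have "Re (of_nat n * ?z) = real n * - (\<sigma> * \<bar>t / real n\<bar>)" by simp
      then show "Re (of_nat n * ?z) = Re ?w" unfolding Re by simp
      have "Im (of_nat n * ?z) = real n * (- (\<sigma> * \<bar>t / real n\<bar>) * l' + \<mu> * (t / real n))" by simp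
      then show "Im (of_nat n * ?z) = Im ?w" unfolding Im by simp
    qed
    then have "exp ?z ^ n = exp ?w" by (simp only: exp_of_nat_mult[symmetric])
    then show "stable_char \<alpha> \<sigma> \<beta> \<mu> (t / real n powr (1 / \<alpha>)) ^ n = iexp (?a * t) * stable_char \<alpha> \<sigma> \<beta> \<mu> t"
      using True unfolding stable_char_def l_def[symmetric] by (simp add: l'_def exp_add)
  qed
qed

lemma (in prob_space) char_distr_affine:
  assumes [measurable]: "W \<in> borel_measurable M"
  shows "char (distr M borel (\<lambda>\<omega>. W \<omega> / N - a)) t = iexp (- a * t) * char (distr M borel W) (t / N)"
proof -
  have "char (distr M borel (\<lambda>\<omega>. W \<omega> / N - a)) t = (CLINT x|M. iexp (- a * t) * iexp (t / N * W x))"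
    unfolding char_def
    by (subst integral_distr) (auto simp: exp_add[symmetric] algebra_simps)
  also have "\<dots> = iexp (- a * t) * (CLINT x|M. iexp (t / N * W x))"
    by (rule integral_mult_right_zero)
  finally show ?thesis by (simp add: char_def integral_distr)
qed

text \<open>
  This is where stability enters: up to a shift, the normalised sum of the \<open>Y i\<close> is itself a copy
  of \<open>Y\<close>. Characteristic functions determine laws, so the preceding scaling identity suffices.
\<close>
lemma (in prob_space) stable_sum_distr:
  fixes Y :: "nat \<Rightarrow> 'a \<Rightarrow> real"
  assumes alpha: "0 < \<alpha>" and n: "n \<ge> 1"
    and indep: "indep_vars (\<lambda>_. borel) Y {1..n}"
    and distr: "\<And>i. i \<in> {1..n} \<Longrightarrow> distr M borel (Y i) = F"
    and stable: "stable_law \<alpha> F"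
  shows "\<exists>a. distr M borel (\<lambda>\<omega>. (\<Sum>i=1..n. Y i \<omega>) / real n powr (1 / \<alpha>) - a) = F"
proof -
  let ?N = "real n powr (1 / \<alpha>)"
  have [measurable]: "Y i \<in> borel_measurable M" if "i \<in> {1..n}" for i
    using indep that by (auto simp: indep_vars_def)
  have sumY [measurable]: "(\<lambda>\<omega>. \<Sum>i=1..n. Y i \<omega>) \<in> borel_measurable M" by measurable
  obtain \<sigma> \<beta> \<mu> where F: "\<And>t. char F t = stable_char \<alpha> \<sigma> \<beta> \<mu> t"
    using stable by (auto simp: stable_law_def)
  obtain a where a: "\<And>t. stable_char \<alpha> \<sigma> \<beta> \<mu> (t / ?N) ^ n = iexp (a * t) * stable_char \<alpha> \<sigma> \<beta> \<mu> t"
    using stable_char_scaling[OF alpha n] by blast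
  let ?G = "distr M borel (\<lambda>\<omega>. (\<Sum>i=1..n. Y i \<omega>) / ?N - a)"
  have "char ?G t = char F t" for t
  proof -
    have "char ?G t = iexp (- a * t) * (\<Prod>i=1..n. char (distr M borel (Y i)) (t / ?N))"
      using sumY by (simp only: char_distr_affine char_distr_sum[OF indep])
    also have "(\<Prod>i=1..n. char (distr M borel (Y i)) (t / ?N)) = (\<Prod>i=1..n. char F (t / ?N))"
      by (intro prod.cong) (auto simp: distr)
    also have "\<dots> = iexp (a * t) * char F t" by (simp add: F a)
    finally show ?thesis by (simp add: exp_minus field_simps)
  qed
  moreover have "real_distribution ?G" by (rule real_distribution_distr) measurable
  moreover have "real_distribution F"
  proof -
    have "distr M borel (Y 1) = F" "Y 1 \<in> borel_measurable M" using n distr by auto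
    then show ?thesis using real_distribution_distr by blast
  qed
  ultimately have "?G = F" by (intro Levy_uniqueness) auto
  then show ?thesis by blast
qed

text \<open>
  The real part has the form \<open>exp (- A s) * cos \<theta>\<close> with \<open>s = t powr \<alpha>\<close>. Since \<open>1 < \<alpha> < 2\<close>, for
  \<open>t \<le> 1\<close> one has \<open>t\<^sup>2 \<le> s \<le> t\<close>: the first inequality absorbs the effect of the shift \<open>\<mu>\<close>, the
  second that of the skewness \<open>\<beta>\<close>.
\<close>
lemma one_minus_Re_stable_char_le:
  assumes alpha: "1 < \<alpha>"  "\<alpha> < 2"
  shows "\<exists>K\<ge>0. \<forall>t. 0 < t \<longrightarrow> t \<le> 1 \<longrightarrow> 1 - Re (stable_char \<alpha> \<sigma> \<beta> \<mu> t) \<le> K * t powr \<alpha>"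
proof -
  define A where "A = \<sigma> powr \<alpha>"
  define B where "B = A * (\<beta> * tan (pi * \<alpha> / 2))"
  define C where "C = \<bar>B\<bar> + \<bar>\<mu>\<bar>"
  have A: "A \<ge> 0" by (simp add: A_def)
  show ?thesis
  proof (intro exI[of _ "A + C\<^sup>2 / 2"] conjI allI impI)
    show "0 \<le> A + C\<^sup>2 / 2" using A by simp
    fix t :: real assume t: "0 < t" "t \<le> 1"
    define s where "s = t powr \<alpha>"
    (* The imaginary part of the exponent of the characteristic function. *)
    define \<theta> where "\<theta> = B * s + \<mu> * t"
    have s: "0 \<le> s" "s \<le> t" using powr_mono'[of 1 \<alpha> t] t alpha by (auto simp: s_def)
    have t2: "t\<^sup>2 \<le> s" using powr_mono'[of \<alpha> 2 t] t alpha by (simp add: s_def)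
    have "\<bar>\<theta>\<bar> \<le> \<bar>B\<bar> * s + \<bar>\<mu>\<bar> * t"
      unfolding \<theta>_def using s t abs_triangle_ineq[of "B * s" "\<mu> * t"] by (simp add: abs_mult)
    also have "\<dots> \<le> \<bar>B\<bar> * t + \<bar>\<mu>\<bar> * t" using s by (intro add_right_mono mult_left_mono) auto
    also have "\<dots> = C * t" by (simp add: C_def algebra_simps)
    finally have "\<bar>\<theta>\<bar>\<^sup>2 \<le> (C * t)\<^sup>2" by (intro power_mono) auto
    also have "\<dots> \<le> C\<^sup>2 * s" using t2 by (simp add: power_mult_distrib mult_left_mono)
    finally have th: "\<theta>\<^sup>2 \<le> C\<^sup>2 * s" by simp
    have "(sin (\<theta> / 2))\<^sup>2 \<le> (\<theta> / 2)\<^sup>2"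
      using abs_sin_x_le_abs_x[of "\<theta> / 2"] unfolding abs_le_square_iff .
    then have cos: "1 - cos \<theta> \<le> \<theta>\<^sup>2 / 2"
      using cos_double_sin[of "\<theta> / 2"] by (simp add: power_divide)
    have "exp (- (A * s)) * (1 - cos \<theta>) \<le> 1 - cos \<theta>"
      using A s by (intro mult_left_le_one_le) auto
    moreover have "1 - A * s \<le> exp (- (A * s))" using exp_ge_add_one_self[of "- (A * s)"] by simp
    ultimately have *: "1 - exp (- (A * s)) * cos \<theta> \<le> A * s + \<theta>\<^sup>2 / 2"
      using cos by (simp add: algebra_simps)
    have "Re (stable_char \<alpha> \<sigma> \<beta> \<mu> t) = exp (- (A * s)) * cos \<theta>"
      using alpha t by (simp add: stable_char_def Re_exp A_def s_def \<theta>_def B_def mult_ac add.commute)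
    with * th show "1 - Re (stable_char \<alpha> \<sigma> \<beta> \<mu> t) \<le> (A + C\<^sup>2 / 2) * t powr \<alpha>"
      by (simp add: s_def[symmetric] algebra_simps)
  qed
qed

text \<open>
  If \<open>\<bar>y\<bar> \<ge> 1\<close>, some dyadic scale \<open>2 ^ k\<close> brings \<open>\<bar>y\<bar> / 2 ^ k\<close> into the interval from \<open>1\<close> to \<open>2\<close>, where
  \<open>1 - cos\<close> is bounded away from zero; that single summand is already comparable to \<open>\<bar>y\<bar>\<close>. The
  right-hand side has an expectation that can be read off a characteristic function.
\<close>
lemma abs_le_dyadic_cos_series:
  obtains \<kappa> :: real where "\<kappa> > 0"
    "\<And>y :: real. ennreal \<bar>y\<bar> \<le> 1 + ennreal \<kappa> * (\<Sum>k. ennreal (2 ^ k * (1 - cos (1 / 2 ^ k * y))))"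
proof
  define \<kappa> where "\<kappa> = 2 / (1 - cos (1 :: real))"
  have c1: "cos (1 :: real) < 1" using cos_monotone_0_pi[of 0 1] pi_gt3 by simp
  then show \<kappa>: "\<kappa> > 0" by (simp add: \<kappa>_def)
  fix y :: real
  show "ennreal \<bar>y\<bar> \<le> 1 + ennreal \<kappa> * (\<Sum>k. ennreal (2 ^ k * (1 - cos (1 / 2 ^ k * y))))"
  proof (cases "\<bar>y\<bar> < 1")
    case True
    then have "ennreal \<bar>y\<bar> \<le> 1" by simp
    then show ?thesis by (rule order_trans[OF _ add_increasing2[OF zero_le order_refl]])
  next
    case False
    obtain m where "\<bar>y\<bar> < 2 ^ m" using real_arch_pow[of 2 "\<bar>y\<bar>"] by auto
    then obtain k where k: "2 ^ k \<le> \<bar>y\<bar>" "\<bar>y\<bar> < 2 ^ Suc k"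
      using exists_least_lemma[of "\<lambda>m. \<bar>y\<bar> < 2 ^ m"] False by (auto simp: not_less)
    define u where "u = 1 / 2 ^ k * \<bar>y\<bar>"
    have u: "1 \<le> u" "u \<le> 2" using k by (auto simp: u_def field_simps)
    have "cos u \<le> cos 1" using u pi_gt3 by (intro cos_monotone_0_pi_le) auto
    moreover have "\<bar>1 / 2 ^ k * y\<bar> = u" by (simp add: u_def abs_mult)
    then have "cos u = cos (1 / 2 ^ k * y)" by (metis cos_abs_real)
    ultimately have cu: "1 - cos 1 \<le> 1 - cos (1 / 2 ^ k * y)" by simp
    have "\<bar>y\<bar> \<le> 2 * 2 ^ k" using k by simp
    also have "\<dots> = \<kappa> * (2 ^ k * (1 - cos 1))" using c1 by (simp add: \<kappa>_def)
    also have "\<dots> \<le> \<kappa> * (2 ^ k * (1 - cos (1 / 2 ^ k * y)))"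
      using cu \<kappa> by (intro mult_left_mono) auto
    finally have "ennreal \<bar>y\<bar> \<le> ennreal \<kappa> * ennreal (2 ^ k * (1 - cos (1 / 2 ^ k * y)))"
      using \<kappa> by (subst ennreal_mult'[symmetric]) (auto intro: ennreal_leI)
    also have "ennreal (2 ^ k * (1 - cos (1 / 2 ^ k * y))) \<le> (\<Sum>k. ennreal (2 ^ k * (1 - cos (1 / 2 ^ k * y))))"
    proof -
      have "f k \<le> (\<Sum>k. f k)" for f :: "nat \<Rightarrow> ennreal"
        using sum_le_suminf[OF summableI, of "{k}" f] by simp
      then show ?thesis .
    qed
    finally have "ennreal \<bar>y\<bar> \<le> ennreal \<kappa> * (\<Sum>k. ennreal (2 ^ k * (1 - cos (1 / 2 ^ k * y))))"
      by (blast intro: mult_left_mono order_trans zero_le)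
    then show ?thesis by (rule add_increasing[OF zero_le])
  qed
qed

text \<open>
  Integrating the dyadic series term by term turns its \<open>k\<close>-th summand into
  \<open>2 ^ k * (1 - Re (char M (1 / 2 ^ k)))\<close>. As the second factor is of order \<open>2 powr (- k * \<alpha>)\<close>, the
  series is dominated by a geometric one of ratio \<open>2 powr (1 - \<alpha>)\<close>, which is less than \<open>1\<close>.
\<close>
lemma (in real_distribution) stable_law_integrable:
  assumes stable: "stable_law \<alpha> M" and alpha: "1 < \<alpha>" "\<alpha> < 2"
  shows "integrable M (\<lambda>x. x)"
proof -
  obtain \<sigma> \<beta> \<mu> where F: "\<And>t. char M t = stable_char \<alpha> \<sigma> \<beta> \<mu> t"
    using stable by (auto simp: stable_law_def)
  obtain K where K: "K \<ge> 0" "\<And>t. 0 < t \<Longrightarrow> t \<le> 1 \<Longrightarrow> 1 - Re (char M t) \<le> K * t powr \<alpha>"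
    using one_minus_Re_stable_char_le[OF alpha] unfolding F by blast
  obtain \<kappa> :: real where \<kappa>: "\<kappa> > 0"
    "\<And>y :: real. ennreal \<bar>y\<bar> \<le> 1 + ennreal \<kappa> * (\<Sum>k. ennreal (2 ^ k * (1 - cos (1 / 2 ^ k * y))))"
    using abs_le_dyadic_cos_series by blast
  define r where "r = 2 powr (1 - \<alpha>)"
  have r: "0 < r" "r < 1" using alpha by (auto simp: r_def powr_less_one)
  have Recos: "(\<integral>\<^sup>+x. ennreal (1 - cos (t * x)) \<partial>M) = ennreal (1 - Re (char M t))" for t
  proof -
    have ii: "integrable M (\<lambda>x. iexp (t * x))" by (rule integrable_iexp) auto
    have cosi: "integrable M (\<lambda>x. cos (t * x))"
      using ii[THEN integrable_Re] by (simp add: Re_exp)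
    have "Re (char M t) = (\<integral>x. cos (t * x) \<partial>M)"
      unfolding char_def using ii by (simp add: integral_Re[symmetric] Re_exp)
    then show ?thesis
      using cosi prob_space by (subst nn_integral_eq_integral) auto
  qed
  have summand_le: "(\<integral>\<^sup>+x. ennreal (2 ^ k * (1 - cos (1 / 2 ^ k * x))) \<partial>M) \<le> ennreal (K * r ^ k)" for k
  proof -
    have "(\<integral>\<^sup>+x. ennreal (2 ^ k * (1 - cos (1 / 2 ^ k * x))) \<partial>M) = ennreal (2 ^ k) * ennreal (1 - Re (char M (1 / 2 ^ k)))"
      unfolding Recos[symmetric] by (subst nn_integral_cmult[symmetric]) (auto simp: ennreal_mult)
    also have "\<dots> \<le> ennreal (2 ^ k) * ennreal (K * (1 / 2 ^ k) powr \<alpha>)"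
      using K(2)[of "1 / 2 ^ k"] by (intro mult_left_mono ennreal_leI) auto
    also have "\<dots> = ennreal (K * (2 ^ k * (1 / 2 ^ k) powr \<alpha>))"
      using K by (simp add: mult_ac flip: ennreal_mult)
    also have "2 ^ k * (1 / 2 ^ k) powr \<alpha> = r ^ k"
    proof -
      have "(1 / 2 ^ k :: real) = 2 powr (- real k)" by (simp add: powr_minus powr_realpow divide_inverse)
      then have "2 ^ k * (1 / 2 ^ k) powr \<alpha> = 2 powr real k * (2 powr (- real k)) powr \<alpha>"
        by (simp add: powr_realpow)
      also have "\<dots> = 2 powr ((1 - \<alpha>) * real k)"
        unfolding powr_powr powr_add[symmetric] by (simp add: algebra_simps)
      also have "\<dots> = r powr real k" unfolding r_def by (rule powr_powr[symmetric])
      also have "\<dots> = r ^ k" using r by (simp add: powr_realpow)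
      finally show ?thesis .
    qed
    finally show ?thesis .
  qed
  have "(\<integral>\<^sup>+x. ennreal \<bar>x\<bar> \<partial>M) \<le> (\<integral>\<^sup>+x. 1 + ennreal \<kappa> * (\<Sum>k. ennreal (2 ^ k * (1 - cos (1 / 2 ^ k * x)))) \<partial>M)"
    by (intro nn_integral_mono \<kappa>)
  also have "\<dots> = 1 + ennreal \<kappa> * (\<Sum>k. \<integral>\<^sup>+x. ennreal (2 ^ k * (1 - cos (1 / 2 ^ k * x))) \<partial>M)"
    using emeasure_space_1 by (simp add: nn_integral_add nn_integral_cmult nn_integral_suminf)
  also have "\<dots> \<le> 1 + ennreal \<kappa> * (\<Sum>k. ennreal (K * r ^ k))"
    by (intro add_left_mono mult_left_mono suminf_le summand_le) auto
  also have "\<dots> < \<infinity>"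
  proof -
    have "(\<Sum>k. ennreal (K * r ^ k)) \<noteq> top"
      using K r by (intro ennreal_suminf_neq_top summable_mult summable_geometric) auto
    then show ?thesis by (auto simp: ennreal_mult_less_top less_top)
  qed
  finally show ?thesis by (intro integrableI_bounded) auto
qed

section \<open>Convergence in the Mallows distance\<close>

lemma ennreal_powr_tendsto_0:
  assumes "f \<longlonglongrightarrow> 0" "0 < p"
  shows "(\<lambda>n. ennreal_powr (f n) p) \<longlonglongrightarrow> 0"
proof -
  have "eventually (\<lambda>n. f n < top) sequentially"
    using assms(1) by (rule order_tendstoD) simp
  moreover have "(\<lambda>n. enn2real (f n)) \<longlonglongrightarrow> 0"
    using tendsto_enn2real[of f 0 sequentially] assms(1) by simp
  then have "(\<lambda>n. enn2real (f n) powr p) \<longlonglongrightarrow> 0"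
    using assms(2) by (intro tendsto_zero_powrI[of _ _ "\<lambda>_. p" p]) auto
  then have "(\<lambda>n. ennreal (enn2real (f n) powr p)) \<longlonglongrightarrow> 0"
    by (simp add: ennreal_tendsto_0_iff)
  ultimately show ?thesis
    by (rule_tac Lim_transform_eventually) (auto elim!: eventually_mono simp: ennreal_powr_def)
qed

lemma (in prob_space) coupling_costs_Inf_le:
  fixes U V :: "'a \<Rightarrow> real"
  assumes "U \<in> borel_measurable M" "V \<in> borel_measurable M" "distr M borel V = G"
  shows "Inf (coupling_costs r (distr M borel U) G) \<le> (\<integral>\<^sup>+\<omega>. ennreal (\<bar>U \<omega> - V \<omega>\<bar> powr r) \<partial>M)"
  using coupling_cost_any_space[OF prob_space_axioms assms(1,2), of r] assms(3) by (intro Inf_lower) simp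

text \<open>
  The Lindeberg condition gives, for each truncation level, a bound by a small constant plus a null
  sequence that itself depends on the level; this lemma lets the level tend to zero.
\<close>
lemma ennreal_tendsto_0_by_bounds:
  fixes e :: "nat \<Rightarrow> ennreal"
  assumes "\<And>\<epsilon> :: real. \<epsilon> > 0 \<Longrightarrow> \<exists>L. L \<longlonglongrightarrow> 0 \<and> (\<forall>n\<ge>1. e n \<le> ennreal \<epsilon> + C * L n)"
    and C: "C < top"
  shows "e \<longlonglongrightarrow> 0"
proof (rule order_tendstoI)
  fix a :: ennreal assume "0 < a"
  then obtain \<epsilon> :: real where \<epsilon>: "\<epsilon> > 0" "ennreal \<epsilon> < a"
  proof -
    obtain b where b: "0 < b" "b < a" using dense[OF \<open>0 < a\<close>] by blast
    then obtain \<epsilon> where "0 \<le> \<epsilon>" "b = ennreal \<epsilon>" by (cases b) auto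
    then show ?thesis using b that[of \<epsilon>] by auto
  qed
  obtain L where L: "L \<longlonglongrightarrow> 0" "\<And>n. n \<ge> 1 \<Longrightarrow> e n \<le> ennreal \<epsilon> + C * L n"
    using assms(1)[OF \<epsilon>(1)] by blast
  have "(\<lambda>n. ennreal \<epsilon> + C * L n) \<longlonglongrightarrow> ennreal \<epsilon> + C * 0"
    using L C by (intro tendsto_add tendsto_const ennreal_tendsto_cmult) auto
  then have "eventually (\<lambda>n. ennreal \<epsilon> + C * L n < a) sequentially"
    using \<epsilon> by (intro order_tendstoD) auto
  then show "eventually (\<lambda>n. e n < a) sequentially"
    using eventually_ge_at_top[of 1] by eventually_elim (use L(2) order_le_less_trans in blast)
qed auto

section \<open>Normalised sums under the Lindeberg condition\<close>

definition clip :: "real \<Rightarrow> real \<Rightarrow> real" where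
  "clip c x = (if \<bar>x\<bar> \<le> c then x else 0)"

lemma clip_measurable [measurable]: "clip c \<in> borel_measurable borel"
  unfolding clip_def[abs_def] by measurable

lemma abs_clip_le: "0 \<le> c \<Longrightarrow> \<bar>clip c x\<bar> \<le> c"
  by (simp add: clip_def)

text \<open>
  The quantity that the Lindeberg condition requires to vanish for every \<open>b\<close>.
\<close>
definition large_jump_mean :: "'a measure \<Rightarrow> real \<Rightarrow> real \<Rightarrow> (nat \<Rightarrow> 'a \<Rightarrow> real) \<Rightarrow> nat \<Rightarrow> ennreal" where
  "large_jump_mean M \<alpha> b D n = ennreal (1 / real n) *
     (\<Sum>i=1..n. \<integral>\<^sup>+\<omega>. ennreal (\<bar>D i \<omega>\<bar> powr \<alpha>) *
        indicator {\<omega>. \<bar>D i \<omega>\<bar> > b * real n powr ((2 - \<alpha>) / (2 * \<alpha>))} \<omega> \<partial>M)"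

lemma large_jump_mean_eq:
  assumes "0 < \<alpha>"
  shows "large_jump_mean M \<alpha> b D n = ennreal (1 / real n) *
     (\<Sum>i=1..n. \<integral>\<^sup>+\<omega>. ennreal (\<bar>D i \<omega> - clip (b * real n powr ((2 - \<alpha>) / (2 * \<alpha>))) (D i \<omega>)\<bar> powr \<alpha>) \<partial>M)"
  unfolding large_jump_mean_def using assms
  by (intro arg_cong2[where f = "(*)"] sum.cong nn_integral_cong refl) (auto simp: clip_def indicator_def)

text \<open>
  Centring doubles the bound \<open>c\<close>, which gives each centred summand a second moment of at most
  \<open>4 * c\<^sup>2\<close>; the other factor \<open>4\<close> is the constant of the moment inequality.
\<close>
lemma (in prob_space) bounded_sum_second_moment:
  fixes T :: "'i \<Rightarrow> 'a \<Rightarrow> real"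
  assumes fin: "finite I" and indep: "indep_vars (\<lambda>_. borel) T I"
    and bound: "\<And>i \<omega>. i \<in> I \<Longrightarrow> \<bar>T i \<omega>\<bar> \<le> c" and c: "0 \<le> c"
  shows "integrable M (\<lambda>\<omega>. \<bar>\<Sum>i\<in>I. T i \<omega> - expectation (T i)\<bar> powr 2) \<and>
    expectation (\<lambda>\<omega>. \<bar>\<Sum>i\<in>I. T i \<omega> - expectation (T i)\<bar> powr 2) \<le> 16 * (real (card I) * c\<^sup>2)"
proof -
  define Z where "Z = (\<lambda>i \<omega>. T i \<omega> - expectation (T i))"
  have rv: "T i \<in> borel_measurable M" if "i \<in> I" for i
    using indep that by (auto simp: indep_vars_def)
  have T: "integrable M (T i)" if "i \<in> I" for i
    using rv[OF that] bound[OF that] by (intro integrable_const_bound[of _ c]) auto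
  have "\<bar>expectation (T i)\<bar> \<le> c" if "i \<in> I" for i
  proof -
    have "\<bar>expectation (T i)\<bar> \<le> expectation (\<lambda>\<omega>. \<bar>T i \<omega>\<bar>)" by (rule integral_abs_bound)
    also have "\<dots> \<le> expectation (\<lambda>_. c)"
      using T[OF that] bound[OF that] by (intro integral_mono) auto
    finally show ?thesis by (simp add: prob_space)
  qed
  then have "\<bar>Z i \<omega>\<bar> \<le> 2 * c" if "i \<in> I" for i \<omega>
    using bound[OF that, of \<omega>] that by (fastforce simp: Z_def)
  then have Z2: "\<bar>Z i \<omega>\<bar> powr 2 \<le> 4 * c\<^sup>2" if "i \<in> I" for i \<omega>
    using power_mono[of "\<bar>Z i \<omega>\<bar>" "2 * c" 2] that by (simp add: power_mult_distrib)
  have Zrv: "Z i \<in> borel_measurable M" if "i \<in> I" for i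
    using rv[OF that] by (simp add: Z_def)
  have int: "integrable M (\<lambda>\<omega>. \<bar>Z i \<omega>\<bar> powr 2)" if "i \<in> I" for i
    using Z2[OF that] Zrv[OF that] by (intro integrable_const_bound[of _ "4 * c\<^sup>2"]) (auto simp del: powr_numeral)
  have ind: "indep_vars (\<lambda>_. borel) Z I"
    unfolding Z_def by (rule indep_vars_compose2[OF indep]) measurable
  have zero: "expectation (Z i) = 0" if "i \<in> I" for i
    using T[OF that] by (simp add: Z_def prob_space)
  have "expectation (\<lambda>\<omega>. \<bar>Z i \<omega>\<bar> powr 2) \<le> 4 * c\<^sup>2" if "i \<in> I" for i
    using integral_mono[OF int[OF that], of "\<lambda>_. 4 * c\<^sup>2"] Z2[OF that] by (simp add: prob_space del: powr_numeral)
  then have "(\<Sum>i\<in>I. expectation (\<lambda>\<omega>. \<bar>Z i \<omega>\<bar> powr 2)) \<le> (\<Sum>i\<in>I. 4 * c\<^sup>2)"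
    by (intro sum_mono)
  then show ?thesis
    using von_Bahr_Esseen[of 2 I Z] fin ind int zero
    unfolding Z_def by (auto simp del: powr_numeral)
qed

text \<open>
  The exponent of the threshold \<open>c\<close> is chosen so that \<open>n * c\<^sup>2 = b\<^sup>2 * (n powr (1 / \<alpha>))\<^sup>2\<close>. Hence
  the normalised sum of the centred truncated variables has second moment at most \<open>(4 * b)\<^sup>2\<close> for
  all \<open>n\<close>, and interpolation at the level \<open>4 * b\<close> bounds its moment of order \<open>\<alpha>\<close>.
\<close>
lemma (in prob_space) small_jumps_bound:
  fixes D :: "nat \<Rightarrow> 'a \<Rightarrow> real"
  assumes alpha: "0 < \<alpha>" "\<alpha> < 2" and n: "n \<ge> 1" and b: "0 < b"
    and indep: "indep_vars (\<lambda>_. borel) D {1..n}"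
    and c: "c = b * real n powr ((2 - \<alpha>) / (2 * \<alpha>))"
  shows "(\<integral>\<^sup>+\<omega>. ennreal (\<bar>(\<Sum>i=1..n. clip c (D i \<omega>) - expectation (\<lambda>\<omega>. clip c (D i \<omega>))) / real n powr (1 / \<alpha>)\<bar> powr \<alpha>) \<partial>M)
      \<le> ennreal (2 * (4 * b) powr \<alpha>)"
proof -
  define T where "T = (\<lambda>i \<omega>. clip c (D i \<omega>))"
  define W where "W = (\<lambda>\<omega>. \<Sum>i=1..n. T i \<omega> - expectation (T i))"
  define N where "N = real n powr (1 / \<alpha>)"
  define a where "a = 4 * b"
  have a: "a > 0" using b by (simp add: a_def)
  have N: "N > 0" using n by (simp add: N_def)
  have "c > 0" using n b by (simp add: c)
  have indT: "indep_vars (\<lambda>_. borel) T {1..n}"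
    unfolding T_def by (rule indep_vars_compose2[OF indep]) measurable
  have [measurable]: "T i \<in> borel_measurable M" if "i \<in> {1..n}" for i
    using indT that by (auto simp: indep_vars_def)
  have [measurable]: "W \<in> borel_measurable M" unfolding W_def by measurable
  have W: "integrable M (\<lambda>\<omega>. \<bar>W \<omega>\<bar> powr 2)" "expectation (\<lambda>\<omega>. \<bar>W \<omega>\<bar> powr 2) \<le> 16 * (real n * c\<^sup>2)"
    using bounded_sum_second_moment[OF _ indT, of c] \<open>c > 0\<close> abs_clip_le[of c]
    by (auto simp: W_def T_def)
  have "(real n powr ((2 - \<alpha>) / (2 * \<alpha>)))\<^sup>2 = real n powr ((2 - \<alpha>) / (2 * \<alpha>) + (2 - \<alpha>) / (2 * \<alpha>))"
    unfolding power2_eq_square powr_add ..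
  also have "(2 - \<alpha>) / (2 * \<alpha>) + (2 - \<alpha>) / (2 * \<alpha>) = (2 - \<alpha>) / \<alpha>"
    using alpha by (simp add: field_simps)
  finally have "c\<^sup>2 = b\<^sup>2 * real n powr ((2 - \<alpha>) / \<alpha>)"
    by (simp add: c power_mult_distrib)
  then have "real n * c\<^sup>2 = b\<^sup>2 * (real n powr 1 * real n powr ((2 - \<alpha>) / \<alpha>))"
    using n by simp
  also have "real n powr 1 * real n powr ((2 - \<alpha>) / \<alpha>) = real n powr (2 / \<alpha>)"
    unfolding powr_add[symmetric] using alpha by (simp add: field_simps)
  also have "\<dots> = N powr 2" by (simp add: N_def powr_powr del: powr_numeral)
  finally have nc: "real n * c\<^sup>2 = b\<^sup>2 * N powr 2" .
  define k where "k = a powr (\<alpha> - 2) / N powr 2"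
  have k: "k \<ge> 0" by (simp add: k_def)
  have pointwise: "\<bar>W \<omega> / N\<bar> powr \<alpha> \<le> a powr \<alpha> + k * \<bar>W \<omega>\<bar> powr 2" for \<omega>
    using abs_powr_le_square[OF a, of \<alpha> "W \<omega> / N"] alpha N
    by (simp add: powr_divide k_def del: powr_numeral)
  have "k * (16 * (real n * c\<^sup>2)) = a powr (\<alpha> - 2) * a powr 2"
    using N a unfolding nc by (simp add: k_def a_def power_mult_distrib)
  also have "\<dots> = a powr \<alpha>" by (simp flip: powr_add del: powr_numeral)
  finally have k_eq: "k * (16 * (real n * c\<^sup>2)) = a powr \<alpha>" .
  have "(\<integral>\<^sup>+\<omega>. ennreal (\<bar>W \<omega> / N\<bar> powr \<alpha>) \<partial>M) \<le> (\<integral>\<^sup>+\<omega>. ennreal (a powr \<alpha> + k * \<bar>W \<omega>\<bar> powr 2) \<partial>M)"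
    by (intro nn_integral_mono ennreal_leI pointwise)
  also have "\<dots> = ennreal (expectation (\<lambda>\<omega>. a powr \<alpha> + k * \<bar>W \<omega>\<bar> powr 2))"
    using W k by (intro nn_integral_eq_integral) (auto simp del: powr_numeral)
  also have "\<dots> = ennreal (a powr \<alpha> + k * expectation (\<lambda>\<omega>. \<bar>W \<omega>\<bar> powr 2))"
    using W by (simp add: prob_space del: powr_numeral)
  also have "\<dots> \<le> ennreal (2 * a powr \<alpha>)"
    using mult_left_mono[OF W(2) k] k_eq by (intro ennreal_leI) linarith
  finally show ?thesis by (simp add: W_def T_def N_def a_def)
qed

text \<open>
  The two ranges of \<open>\<alpha>\<close> differ only in how the sum of the large jumps is estimated and in the
  constant \<open>\<rho>\<close> by which it is centred; this lemma adds the small jumps to either estimate. The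
  factor \<open>32\<close> is what the case \<open>\<alpha> > 1\<close> produces; separating the two kinds of jumps multiplies the
  bounds by \<open>4\<close>.
\<close>
lemma (in prob_space) normalised_sum_bound:
  fixes D :: "nat \<Rightarrow> 'a \<Rightarrow> real"
  assumes alpha: "0 < \<alpha>" "\<alpha> < 2" and n: "n \<ge> 1" and b: "0 < b"
    and indep: "indep_vars (\<lambda>_. borel) D {1..n}"
    and c: "c = b * real n powr ((2 - \<alpha>) / (2 * \<alpha>))"
    and N: "N = real n powr (1 / \<alpha>)"
    and large: "(\<integral>\<^sup>+\<omega>. ennreal (\<bar>((\<Sum>i=1..n. D i \<omega> - clip c (D i \<omega>)) - \<rho>) / N\<bar> powr \<alpha>) \<partial>M) \<le> 32 * L"
  shows "(\<integral>\<^sup>+\<omega>. ennreal (\<bar>(\<Sum>i=1..n. D i \<omega>) / N - ((\<Sum>i=1..n. expectation (\<lambda>\<omega>. clip c (D i \<omega>))) + \<rho>) / N\<bar> powr \<alpha>) \<partial>M)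
      \<le> ennreal (8 * (4 * b) powr \<alpha>) + 128 * L"
proof -
  define U where "U = (\<lambda>\<omega>. (\<Sum>i=1..n. clip c (D i \<omega>) - expectation (\<lambda>\<omega>. clip c (D i \<omega>))) / N)"
  define V where "V = (\<lambda>\<omega>. ((\<Sum>i=1..n. D i \<omega> - clip c (D i \<omega>)) - \<rho>) / N)"
  have [measurable]: "D i \<in> borel_measurable M" if "i \<in> {1..n}" for i
    using indep that by (auto simp: indep_vars_def)
  have [measurable]: "U \<in> borel_measurable M" "V \<in> borel_measurable M"
    unfolding U_def V_def by measurable
  have "(\<integral>\<^sup>+\<omega>. ennreal (\<bar>U \<omega> + V \<omega>\<bar> powr \<alpha>) \<partial>M)
      \<le> (\<integral>\<^sup>+\<omega>. 4 * (ennreal (\<bar>U \<omega>\<bar> powr \<alpha>) + ennreal (\<bar>V \<omega>\<bar> powr \<alpha>)) \<partial>M)"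
  proof (intro nn_integral_mono)
    fix \<omega>
    have "ennreal (\<bar>U \<omega> + V \<omega>\<bar> powr \<alpha>) \<le> ennreal (4 * (\<bar>U \<omega>\<bar> powr \<alpha> + \<bar>V \<omega>\<bar> powr \<alpha>))"
      using abs_add_powr_le[of \<alpha> "U \<omega>" "V \<omega>"] alpha by (intro ennreal_leI) auto
    also have "\<dots> = 4 * (ennreal (\<bar>U \<omega>\<bar> powr \<alpha>) + ennreal (\<bar>V \<omega>\<bar> powr \<alpha>))"
      by (simp add: ennreal_mult)
    finally show "ennreal (\<bar>U \<omega> + V \<omega>\<bar> powr \<alpha>) \<le> 4 * (ennreal (\<bar>U \<omega>\<bar> powr \<alpha>) + ennreal (\<bar>V \<omega>\<bar> powr \<alpha>))" .
  qed
  also have "\<dots> = 4 * ((\<integral>\<^sup>+\<omega>. ennreal (\<bar>U \<omega>\<bar> powr \<alpha>) \<partial>M) + (\<integral>\<^sup>+\<omega>. ennreal (\<bar>V \<omega>\<bar> powr \<alpha>) \<partial>M))"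
    by (subst nn_integral_cmult) (auto simp: nn_integral_add)
  also have "\<dots> \<le> 4 * (ennreal (2 * (4 * b) powr \<alpha>) + 32 * L)"
    using small_jumps_bound[OF alpha n b indep c] large
    unfolding U_def V_def N by (intro mult_left_mono add_mono) auto
  also have "\<dots> = ennreal (8 * (4 * b) powr \<alpha>) + 128 * L"
  proof -
    have "4 * ennreal (2 * (4 * b) powr \<alpha>) = ennreal (8 * (4 * b) powr \<alpha>)"
      using ennreal_mult[of 4 "2 * (4 * b) powr \<alpha>"] by simp
    moreover have "4 * (32 * L) = 128 * L" by (simp flip: mult.assoc)
    ultimately show ?thesis by (simp only: distrib_left)
  qed
  finally have "(\<integral>\<^sup>+\<omega>. ennreal (\<bar>U \<omega> + V \<omega>\<bar> powr \<alpha>) \<partial>M) \<le> ennreal (8 * (4 * b) powr \<alpha>) + 128 * L" .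
  moreover have "U \<omega> + V \<omega> = (\<Sum>i=1..n. D i \<omega>) / N - ((\<Sum>i=1..n. expectation (\<lambda>\<omega>. clip c (D i \<omega>))) + \<rho>) / N" for \<omega>
    by (simp add: U_def V_def sum_subtractf diff_divide_distrib add_divide_distrib)
  ultimately show ?thesis by simp
qed

text \<open>
  For \<open>\<alpha> \<le> 1\<close> the power is subadditive and the large jumps may be summed without centring; their
  expectations may not even exist, so \<open>m\<close> is taken to be the normalised sum of the truncated means.
\<close>
lemma (in prob_space) normalised_sum_bound_le_1:
  fixes D :: "nat \<Rightarrow> 'a \<Rightarrow> real"
  assumes alpha: "0 < \<alpha>" "\<alpha> \<le> 1" and n: "n \<ge> 1" and b: "0 < b"
    and indep: "indep_vars (\<lambda>_. borel) D {1..n}"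
  shows "\<exists>m. (\<integral>\<^sup>+\<omega>. ennreal (\<bar>(\<Sum>i=1..n. D i \<omega>) / real n powr (1 / \<alpha>) - m\<bar> powr \<alpha>) \<partial>M)
      \<le> ennreal (8 * (4 * b) powr \<alpha>) + 128 * large_jump_mean M \<alpha> b D n"
proof -
  define c where "c = b * real n powr ((2 - \<alpha>) / (2 * \<alpha>))"
  define R where "R = (\<lambda>i \<omega>. D i \<omega> - clip c (D i \<omega>))"
  let ?N = "real n powr (1 / \<alpha>)" and ?L = "large_jump_mean M \<alpha> b D n"
  have N: "?N powr \<alpha> = real n" using alpha by (simp add: powr_powr)
  have [measurable]: "D i \<in> borel_measurable M" if "i \<in> {1..n}" for i
    using indep that by (auto simp: indep_vars_def)
  have [measurable]: "R i \<in> borel_measurable M" if "i \<in> {1..n}" for i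
    unfolding R_def using that by measurable
  have "(\<integral>\<^sup>+\<omega>. ennreal (\<bar>((\<Sum>i=1..n. R i \<omega>) - 0) / ?N\<bar> powr \<alpha>) \<partial>M)
      \<le> (\<integral>\<^sup>+\<omega>. ennreal (1 / real n) * (\<Sum>i=1..n. ennreal (\<bar>R i \<omega>\<bar> powr \<alpha>)) \<partial>M)"
  proof (intro nn_integral_mono)
    fix \<omega>
    have "\<bar>((\<Sum>i=1..n. R i \<omega>) - 0) / ?N\<bar> powr \<alpha> = 1 / real n * \<bar>\<Sum>i=1..n. R i \<omega>\<bar> powr \<alpha>"
      using N by (simp add: powr_divide)
    also have "\<dots> \<le> 1 / real n * (\<Sum>i=1..n. \<bar>R i \<omega>\<bar> powr \<alpha>)"
      using alpha by (intro mult_left_mono abs_sum_powr_le) auto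
    finally show "ennreal (\<bar>((\<Sum>i=1..n. R i \<omega>) - 0) / ?N\<bar> powr \<alpha>) \<le> ennreal (1 / real n) * (\<Sum>i=1..n. ennreal (\<bar>R i \<omega>\<bar> powr \<alpha>))"
      by (subst sum_ennreal, simp, subst ennreal_mult[symmetric]) (auto intro: ennreal_leI sum_nonneg)
  qed
  also have "\<dots> = ?L"
  proof -
    have rv: "(\<lambda>\<omega>. ennreal (\<bar>R i \<omega>\<bar> powr \<alpha>)) \<in> borel_measurable M" if "i \<in> {1..n}" for i
      using that by measurable
    have "?L = ennreal (1 / real n) * (\<Sum>i=1..n. \<integral>\<^sup>+\<omega>. ennreal (\<bar>R i \<omega>\<bar> powr \<alpha>) \<partial>M)"
      by (simp only: large_jump_mean_eq[OF alpha(1)] R_def c_def)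
    then show ?thesis
      by (simp only: nn_integral_cmult[OF borel_measurable_sum[OF rv]] nn_integral_sum[OF rv])
  qed
  also have "\<dots> \<le> 32 * ?L" using mult_right_mono[of 1 32 ?L] by simp
  finally show ?thesis
    using normalised_sum_bound[OF _ _ n b indep c_def refl, of 0 ?L] alpha unfolding R_def by fastforce
qed

text \<open>
  For \<open>\<alpha> > 1\<close> each large jump is centred at its mean, and the moment inequality of order \<open>\<alpha>\<close> takes
  the place of subadditivity. This costs a constant \<open>32 = 4 * 8\<close>: a factor \<open>4\<close> from that inequality and a
  factor \<open>8\<close> from the centring. The truncated means and the means of the large jumps add up to the
  means of the \<open>D i\<close>, so that the total centring is explicit.
\<close>
lemma (in prob_space) normalised_sum_bound_gt_1:
  fixes D :: "nat \<Rightarrow> 'a \<Rightarrow> real"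
  assumes alpha: "1 < \<alpha>" "\<alpha> < 2" and n: "n \<ge> 1" and b: "0 < b"
    and indep: "indep_vars (\<lambda>_. borel) D {1..n}"
    and int: "\<And>i. i \<in> {1..n} \<Longrightarrow> integrable M (D i)"
  shows "(\<integral>\<^sup>+\<omega>. ennreal (\<bar>(\<Sum>i=1..n. D i \<omega>) / real n powr (1 / \<alpha>) - (\<Sum>i=1..n. expectation (D i)) / real n powr (1 / \<alpha>)\<bar> powr \<alpha>) \<partial>M)
      \<le> ennreal (8 * (4 * b) powr \<alpha>) + 128 * large_jump_mean M \<alpha> b D n"
proof (cases "large_jump_mean M \<alpha> b D n = top")
  case True
  then show ?thesis by (simp add: ennreal_mult_eq_top_iff)
next
  case False
  define c where "c = b * real n powr ((2 - \<alpha>) / (2 * \<alpha>))"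
  define R where "R = (\<lambda>i \<omega>. D i \<omega> - clip c (D i \<omega>))"
  define Z where "Z = (\<lambda>i \<omega>. R i \<omega> - expectation (R i))"
  let ?N = "real n powr (1 / \<alpha>)" and ?L = "large_jump_mean M \<alpha> b D n"
  have alpha0: "0 < \<alpha>" using alpha by simp
  have N: "?N powr \<alpha> = real n" using alpha by (simp add: powr_powr)
  have Drv [measurable]: "D i \<in> borel_measurable M" if "i \<in> {1..n}" for i
    using indep that by (auto simp: indep_vars_def)
  have Rrv [measurable]: "R i \<in> borel_measurable M" if "i \<in> {1..n}" for i
    unfolding R_def using that by measurable
  have L: "?L = ennreal (1 / real n) * (\<Sum>i=1..n. \<integral>\<^sup>+\<omega>. ennreal (\<bar>R i \<omega>\<bar> powr \<alpha>) \<partial>M)"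
    by (simp add: large_jump_mean_eq[OF alpha0] R_def c_def)
  then have "(\<Sum>i=1..n. \<integral>\<^sup>+\<omega>. ennreal (\<bar>R i \<omega>\<bar> powr \<alpha>) \<partial>M) \<noteq> top"
    using False n by (auto simp: ennreal_mult_eq_top_iff)
  then have "(\<integral>\<^sup>+\<omega>. ennreal (\<bar>R i \<omega>\<bar> powr \<alpha>) \<partial>M) < top" if "i \<in> {1..n}" for i
    using that by (auto simp: less_top)
  then have Rp: "integrable M (\<lambda>\<omega>. \<bar>R i \<omega>\<bar> powr \<alpha>)" if "i \<in> {1..n}" for i
    using that by (intro integrableI_bounded) auto
  have L_real: "?L = ennreal (1 / real n * (\<Sum>i=1..n. expectation (\<lambda>\<omega>. \<bar>R i \<omega>\<bar> powr \<alpha>)))"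
  proof -
    have "(\<Sum>i=1..n. \<integral>\<^sup>+\<omega>. ennreal (\<bar>R i \<omega>\<bar> powr \<alpha>) \<partial>M) = (\<Sum>i=1..n. ennreal (expectation (\<lambda>\<omega>. \<bar>R i \<omega>\<bar> powr \<alpha>)))"
      using Rp by (intro sum.cong nn_integral_eq_integral) auto
    then show ?thesis
      unfolding L by (subst ennreal_mult) (auto simp: sum_nonneg)
  qed
  have R: "integrable M (R i)" if "i \<in> {1..n}" for i
    using integrable_of_powr_integrable[OF Rrv Rp] that alpha by simp
  have clip_int: "integrable M (\<lambda>\<omega>. clip c (D i \<omega>))" if "i \<in> {1..n}" for i
    using Bochner_Integration.integrable_diff[OF int[OF that] R[OF that]] by (simp add: R_def)
  have indZ: "indep_vars (\<lambda>_. borel) Z {1..n}"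
    unfolding Z_def R_def by (rule indep_vars_compose2[OF indep]) measurable
  have Zp: "integrable M (\<lambda>\<omega>. \<bar>Z i \<omega>\<bar> powr \<alpha>)" if "i \<in> {1..n}" for i
    using integrable_abs_add_powr[of "R i" "\<lambda>_. - expectation (R i)" \<alpha>] Rp[OF that] Rrv[OF that] alpha
    by (simp add: Z_def)
  have Z0: "expectation (Z i) = 0" if "i \<in> {1..n}" for i
    using R[OF that] by (simp add: Z_def prob_space)
  have ZR: "expectation (\<lambda>\<omega>. \<bar>Z i \<omega>\<bar> powr \<alpha>) \<le> 8 * expectation (\<lambda>\<omega>. \<bar>R i \<omega>\<bar> powr \<alpha>)" if "i \<in> {1..n}" for i
  proof -
    have "expectation (\<lambda>\<omega>. \<bar>Z i \<omega>\<bar> powr \<alpha>) \<le> expectation (\<lambda>\<omega>. 4 * (\<bar>R i \<omega>\<bar> powr \<alpha> + \<bar>expectation (R i)\<bar> powr \<alpha>))"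
      using Zp[OF that] Rp[OF that] abs_add_powr_le[of \<alpha> "R i _" "- expectation (R i)"] alpha
      by (intro integral_mono) (auto simp: Z_def)
    also have "\<dots> = 4 * (expectation (\<lambda>\<omega>. \<bar>R i \<omega>\<bar> powr \<alpha>) + \<bar>expectation (R i)\<bar> powr \<alpha>)"
      using Rp[OF that] by (simp add: prob_space)
    finally show ?thesis
      using abs_expectation_powr_le[OF Rrv[OF that] Rp[OF that] alpha(1)] by simp
  qed
  have vBE: "integrable M (\<lambda>\<omega>. \<bar>\<Sum>i=1..n. Z i \<omega>\<bar> powr \<alpha>)"
    "expectation (\<lambda>\<omega>. \<bar>\<Sum>i=1..n. Z i \<omega>\<bar> powr \<alpha>) \<le> 4 * (\<Sum>i=1..n. expectation (\<lambda>\<omega>. \<bar>Z i \<omega>\<bar> powr \<alpha>))"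
    using von_Bahr_Esseen[OF alpha(1) _ _ indZ Zp Z0] alpha by auto
  (* The power of the normalising constant is exactly n. *)
  have Zsum: "\<bar>((\<Sum>i=1..n. R i \<omega>) - (\<Sum>i=1..n. expectation (R i))) / ?N\<bar> powr \<alpha>
      = 1 / real n * \<bar>\<Sum>i=1..n. Z i \<omega>\<bar> powr \<alpha>" for \<omega>
    using N by (simp add: powr_divide Z_def sum_subtractf)
  have "(\<integral>\<^sup>+\<omega>. ennreal (\<bar>((\<Sum>i=1..n. R i \<omega>) - (\<Sum>i=1..n. expectation (R i))) / ?N\<bar> powr \<alpha>) \<partial>M)
      = ennreal (1 / real n * expectation (\<lambda>\<omega>. \<bar>\<Sum>i=1..n. Z i \<omega>\<bar> powr \<alpha>))"
    unfolding Zsum using vBE(1) by (subst nn_integral_eq_integral) auto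
  also have "\<dots> \<le> ennreal (32 * (1 / real n * (\<Sum>i=1..n. expectation (\<lambda>\<omega>. \<bar>R i \<omega>\<bar> powr \<alpha>))))"
  proof (intro ennreal_leI)
    have "(\<Sum>i=1..n. expectation (\<lambda>\<omega>. \<bar>Z i \<omega>\<bar> powr \<alpha>)) \<le> 8 * (\<Sum>i=1..n. expectation (\<lambda>\<omega>. \<bar>R i \<omega>\<bar> powr \<alpha>))"
      unfolding sum_distrib_left by (intro sum_mono ZR)
    then have "expectation (\<lambda>\<omega>. \<bar>\<Sum>i=1..n. Z i \<omega>\<bar> powr \<alpha>) \<le> 32 * (\<Sum>i=1..n. expectation (\<lambda>\<omega>. \<bar>R i \<omega>\<bar> powr \<alpha>))"
      using vBE(2) by linarith
    then have "1 / real n * expectation (\<lambda>\<omega>. \<bar>\<Sum>i=1..n. Z i \<omega>\<bar> powr \<alpha>) \<le> 1 / real n * (32 * (\<Sum>i=1..n. expectation (\<lambda>\<omega>. \<bar>R i \<omega>\<bar> powr \<alpha>)))"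
      by (intro mult_left_mono) auto
    then show "1 / real n * expectation (\<lambda>\<omega>. \<bar>\<Sum>i=1..n. Z i \<omega>\<bar> powr \<alpha>) \<le> 32 * (1 / real n * (\<Sum>i=1..n. expectation (\<lambda>\<omega>. \<bar>R i \<omega>\<bar> powr \<alpha>)))"
      by simp
  qed
  also have "\<dots> = 32 * ?L"
    unfolding L_real by (subst ennreal_mult) (auto simp: sum_nonneg)
  finally have large: "(\<integral>\<^sup>+\<omega>. ennreal (\<bar>((\<Sum>i=1..n. D i \<omega> - clip c (D i \<omega>)) - (\<Sum>i=1..n. expectation (R i))) / ?N\<bar> powr \<alpha>) \<partial>M) \<le> 32 * ?L"
    by (simp add: R_def)
  have "expectation (R i) = expectation (D i) - expectation (\<lambda>\<omega>. clip c (D i \<omega>))" if "i \<in> {1..n}" for i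
    unfolding R_def using int[OF that] clip_int[OF that] by simp
  then have means: "(\<Sum>i=1..n. expectation (\<lambda>\<omega>. clip c (D i \<omega>))) + (\<Sum>i=1..n. expectation (R i)) = (\<Sum>i=1..n. expectation (D i))"
    by (simp add: sum_subtractf)
  show ?thesis
    using normalised_sum_bound[OF alpha0 alpha(2) n b indep c_def refl large] unfolding means .
qed

text \<open>
  The Lindeberg condition forces the quantity to be finite for all large \<open>n\<close>, and then every
  variable with index up to \<open>n\<close> is a bounded one plus one with finite moment of order \<open>\<alpha>\<close>.
\<close>
lemma (in prob_space) integrable_of_finite_large_jump_mean:
  assumes alpha: "1 \<le> \<alpha>" and [measurable]: "D i \<in> borel_measurable M"
    and fin: "large_jump_mean M \<alpha> b D n < top" and i: "1 \<le> i" "i \<le> n"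
  shows "integrable M (D i)"
proof -
  define c where "c = b * real n powr ((2 - \<alpha>) / (2 * \<alpha>))"
  have "(\<Sum>i=1..n. \<integral>\<^sup>+\<omega>. ennreal (\<bar>D i \<omega> - clip c (D i \<omega>)\<bar> powr \<alpha>) \<partial>M) \<noteq> top"
    using fin alpha i by (subst (asm) large_jump_mean_eq) (auto simp: c_def ennreal_mult_less_top)
  then have "(\<integral>\<^sup>+\<omega>. ennreal (\<bar>D i \<omega> - clip c (D i \<omega>)\<bar> powr \<alpha>) \<partial>M) < top"
    using i by (auto simp: less_top)
  then have "integrable M (\<lambda>\<omega>. \<bar>D i \<omega> - clip c (D i \<omega>)\<bar> powr \<alpha>)"
    by (intro integrableI_bounded) auto
  then have 1: "integrable M (\<lambda>\<omega>. D i \<omega> - clip c (D i \<omega>))"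
    using alpha by (rule_tac integrable_of_powr_integrable) auto
  have 2: "integrable M (\<lambda>\<omega>. clip c (D i \<omega>))"
    by (rule integrable_const_bound[of _ "\<bar>c\<bar>"]) (auto simp: clip_def)
  show ?thesis using Bochner_Integration.integrable_add[OF 1 2] by simp
qed

section \<open>Convergence to the stable law\<close>

theorem theorem1:
  fixes \<alpha> :: real
    and M :: "'a measure" and X Y :: "nat \<Rightarrow> 'a \<Rightarrow> real"
    and N :: "'b measure" and Y0 :: "'b \<Rightarrow> real"
    and S :: "nat \<Rightarrow> 'a \<Rightarrow> real"
  assumes alpha: "0 < \<alpha>" "\<alpha> < 2"
    and prob_M: "prob_space M"
    and prob_N: "prob_space N"
    and rv_Y0: "Y0 \<in> borel_measurable N"
    and stable: "stable_law \<alpha> (distr N borel Y0)"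
    and rv_X: "\<And>i. i \<ge> 1 \<Longrightarrow> X i \<in> borel_measurable M"
    and rv_Y: "\<And>i. i \<ge> 1 \<Longrightarrow> Y i \<in> borel_measurable M"
    and indep: "prob_space.indep_vars M (\<lambda>_. borel \<Otimes>\<^sub>M borel) (\<lambda>i \<omega>. (X i \<omega>, Y i \<omega>)) {1..}"
    and copies: "\<And>i. i \<ge> 1 \<Longrightarrow> distr M borel (Y i) = distr N borel Y0"
    and lindeberg: "\<And>b. b > 0 \<Longrightarrow>
      (\<lambda>n. ennreal (1 / real n) *
         (\<Sum>i=1..n. \<integral>\<^sup>+\<omega>. ennreal (\<bar>X i \<omega> - Y i \<omega>\<bar> powr \<alpha>) *
            indicator {\<omega>. \<bar>X i \<omega> - Y i \<omega>\<bar> > b * real n powr ((2 - \<alpha>) / (2 * \<alpha>))} \<omega> \<partial>M))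
      \<longlonglongrightarrow> 0"
    and S: "\<And>n \<omega>. S n \<omega> = (\<Sum>i=1..n. X i \<omega>) / real n powr (1 / \<alpha>)"
  shows "(\<exists>c :: nat \<Rightarrow> real.
            (\<lambda>n. mallows_dist \<alpha> (distr M borel (\<lambda>\<omega>. S n \<omega> - c n)) (distr N borel Y0))
              \<longlonglongrightarrow> 0)
       \<and> (1 < \<alpha> \<longrightarrow>
            (\<forall>i\<ge>1. integrable M (X i)) \<and> integrable N Y0 \<and>
            (\<lambda>n. mallows_dist \<alpha>
                   (distr M borel (\<lambda>\<omega>. S n \<omega> -
                      (real n powr (- 1 / \<alpha>) * (\<Sum>i=1..n. \<integral>\<omega>. X i \<omega> \<partial>M) - (\<integral>\<omega>. Y0 \<omega> \<partial>N))))
                   (distr N borel Y0))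
              \<longlonglongrightarrow> 0)"
proof -
  interpret M: prob_space M by (rule prob_M)
  interpret N: prob_space N by (rule prob_N)
  define F where "F = distr N borel Y0"
  define D where "D = (\<lambda>i \<omega>. X i \<omega> - Y i \<omega>)"
  define J where "J = (\<lambda>n c. Inf (coupling_costs \<alpha> (distr M borel (\<lambda>\<omega>. S n \<omega> - c)) F))"
  have mallows: "mallows_dist \<alpha> (distr M borel (\<lambda>\<omega>. S n \<omega> - c)) (distr N borel Y0) = ennreal_powr (J n c) (1 / \<alpha>)" for n c
    by (simp add: mallows_dist_def J_def F_def)
  have sumY [measurable]: "(\<lambda>\<omega>. \<Sum>i=1..n. Y i \<omega>) \<in> borel_measurable M" for n
    by (intro borel_measurable_sum rv_Y) simp
  have Srv [measurable]: "S n \<in> borel_measurable M" for n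
  proof -
    have "S n = (\<lambda>\<omega>. (\<Sum>i=1..n. X i \<omega>) / real n powr (1 / \<alpha>))" using S by blast
    also have "\<dots> \<in> borel_measurable M"
      by (intro borel_measurable_divide borel_measurable_sum borel_measurable_const rv_X) simp
    finally show ?thesis .
  qed
  have indXY: "M.indep_vars (\<lambda>_. borel \<Otimes>\<^sub>M borel) (\<lambda>i \<omega>. (X i \<omega>, Y i \<omega>)) {1..n}" for n
    by (rule M.indep_vars_subset[OF indep]) auto
  have indD: "M.indep_vars (\<lambda>_. borel) D {1..n}" for n
    using M.indep_vars_compose2[OF indXY, where N = "\<lambda>_. borel" and Y = "\<lambda>_ (x, y). x - y"] by (simp add: D_def)
  have indY: "M.indep_vars (\<lambda>_. borel) Y {1..n}" for n
    using M.indep_vars_compose2[OF indXY, where N = "\<lambda>_. borel" and Y = "\<lambda>_. snd"] by simp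
  have L: "large_jump_mean M \<alpha> b D \<longlonglongrightarrow> 0" if "b > 0" for b
    using lindeberg[OF that] unfolding large_jump_mean_def[abs_def] D_def .
  have "\<exists>a. distr M borel (\<lambda>\<omega>. (\<Sum>i=1..n. Y i \<omega>) / real n powr (1 / \<alpha>) - a) = F" if "n \<ge> 1" for n
    using M.stable_sum_distr[OF alpha(1) that indY _ stable] copies by (simp add: F_def)
  (* The variables shifted by a n are the copies of Y0 with which S n is coupled. *)
  then obtain a where a: "\<And>n. n \<ge> 1 \<Longrightarrow> distr M borel (\<lambda>\<omega>. (\<Sum>i=1..n. Y i \<omega>) / real n powr (1 / \<alpha>) - a n) = F"
    by metis
  have J_le: "J n (a n + m) \<le> (\<integral>\<^sup>+\<omega>. ennreal (\<bar>(\<Sum>i=1..n. D i \<omega>) / real n powr (1 / \<alpha>) - m\<bar> powr \<alpha>) \<partial>M)" if "n \<ge> 1" for n m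
  proof -
    have "(S n \<omega> - (a n + m)) - ((\<Sum>i=1..n. Y i \<omega>) / real n powr (1 / \<alpha>) - a n) = (\<Sum>i=1..n. D i \<omega>) / real n powr (1 / \<alpha>) - m" for \<omega>
      by (simp add: S D_def sum_subtractf diff_divide_distrib)
    moreover have "J n (a n + m) \<le> (\<integral>\<^sup>+\<omega>. ennreal (\<bar>(S n \<omega> - (a n + m)) - ((\<Sum>i=1..n. Y i \<omega>) / real n powr (1 / \<alpha>) - a n)\<bar> powr \<alpha>) \<partial>M)"
      unfolding J_def by (intro M.coupling_costs_Inf_le a that) measurable
    ultimately show ?thesis by (simp only:)
  qed
  (* The parameter b for which the bound on the contribution of the small jumps equals epsilon. *)
  have radius: "\<exists>b>0. 8 * (4 * b) powr \<alpha> = \<epsilon>" if "\<epsilon> > 0" for \<epsilon>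
    using that alpha by (intro exI[of _ "(\<epsilon> / 8) powr (1 / \<alpha>) / 4"]) (simp add: powr_powr)
  show ?thesis
  proof (cases "\<alpha> \<le> 1")
    case True
    (* The centring found above depends on b as well as on n, whereas the constants sought depend
       on n alone. So the infimum over all centrings is shown to vanish, and then constants that
       nearly attain it are chosen. *)
    define I where "I = (\<lambda>n. INF c. J n c)"
    have "I \<longlonglongrightarrow> 0"
    proof (rule ennreal_tendsto_0_by_bounds)
      fix \<epsilon> :: real assume "\<epsilon> > 0"
      then obtain b where b: "b > 0" "8 * (4 * b) powr \<alpha> = \<epsilon>" using radius by blast
      have "I n \<le> ennreal \<epsilon> + 128 * large_jump_mean M \<alpha> b D n" if n: "n \<ge> 1" for n
      proof -
        obtain m where "(\<integral>\<^sup>+\<omega>. ennreal (\<bar>(\<Sum>i=1..n. D i \<omega>) / real n powr (1 / \<alpha>) - m\<bar> powr \<alpha>) \<partial>M)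
            \<le> ennreal \<epsilon> + 128 * large_jump_mean M \<alpha> b D n"
          using M.normalised_sum_bound_le_1[OF alpha(1) True n b(1) indD] b(2) by auto
        moreover have "I n \<le> J n (a n + m)" unfolding I_def by (rule INF_lower) simp
        ultimately show ?thesis using J_le[OF n, of m] by (meson order_trans)
      qed
      then show "\<exists>L. L \<longlonglongrightarrow> 0 \<and> (\<forall>n\<ge>1. I n \<le> ennreal \<epsilon> + 128 * L n)"
        using L[OF b(1)] by blast
    qed simp
    have "\<exists>c. J n c \<le> I n + ennreal (1 / real (Suc n))" for n
    proof (cases "I n = top")
      case False
      then have "I n < I n + ennreal (1 / real (Suc n))"
        using ennreal_add_left_cancel_less[of "I n" 0 "ennreal (1 / real (Suc n))"] by simp
      then obtain c where "J n c < I n + ennreal (1 / real (Suc n))"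
        unfolding I_def by (auto simp: INF_less_iff)
      then show ?thesis by (auto intro: less_imp_le)
    qed simp
    then obtain c where c: "\<And>n. J n (c n) \<le> I n + ennreal (1 / real (Suc n))" by metis
    have "(\<lambda>n. ennreal (1 / real (Suc n))) \<longlonglongrightarrow> 0"
      using LIMSEQ_inverse_real_of_nat by (simp add: ennreal_tendsto_0_iff inverse_eq_divide)
    then have "(\<lambda>n. I n + ennreal (1 / real (Suc n))) \<longlonglongrightarrow> 0 + 0"
      by (intro tendsto_add \<open>I \<longlonglongrightarrow> 0\<close>)
    then have upper: "(\<lambda>n. I n + ennreal (1 / real (Suc n))) \<longlonglongrightarrow> 0" by simp
    have "(\<lambda>n. J n (c n)) \<longlonglongrightarrow> 0"
      by (rule tendsto_sandwich[OF _ _ tendsto_const upper]) (use c in \<open>simp_all del: of_nat_Suc\<close>)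
    then show ?thesis
      unfolding mallows using True alpha by (auto intro!: exI[of _ c] ennreal_powr_tendsto_0)
  next
    case False
    then have alpha1: "1 < \<alpha>" by simp
    have intY0: "integrable N Y0"
      using real_distribution.stable_law_integrable[OF _ stable alpha1 alpha(2)] rv_Y0 N.real_distribution_distr
      by (simp add: integrable_distr_eq)
    have intY: "integrable M (Y i)" and EY: "M.expectation (Y i) = N.expectation Y0" if "i \<ge> 1" for i
    proof -
      have "integrable (distr M borel (Y i)) (\<lambda>x. x)"
        unfolding copies[OF that] using intY0 rv_Y0 by (simp add: integrable_distr_eq)
      then show "integrable M (Y i)" using rv_Y[OF that] by (simp add: integrable_distr_eq)
      have "(\<integral>x. x \<partial>distr M borel (Y i)) = (\<integral>x. x \<partial>distr N borel Y0)"
        by (simp only: copies[OF that])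
      then show "M.expectation (Y i) = N.expectation Y0"
        using rv_Y[OF that] rv_Y0 by (simp add: integral_distr)
    qed
    have intD: "integrable M (D i)" if i: "i \<ge> 1" for i
    proof -
      have "eventually (\<lambda>n. large_jump_mean M \<alpha> 1 D n < top) sequentially"
        using L[of 1] by (intro order_tendstoD) auto
      then obtain n where "large_jump_mean M \<alpha> 1 D n < top" "i \<le> n"
        using eventually_happens[OF eventually_conj[OF _ eventually_ge_at_top[of i]]] by auto
      then show ?thesis
        using alpha1 i rv_X[OF i] rv_Y[OF i]
        by (intro M.integrable_of_finite_large_jump_mean[of \<alpha> D i 1 n]) (auto simp: D_def)
    qed
    have intX: "integrable M (X i)" if "i \<ge> 1" for i
      using Bochner_Integration.integrable_add[OF intD[OF that] intY[OF that]] by (simp add: D_def)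
    define c where "c = (\<lambda>n. real n powr (- 1 / \<alpha>) * (\<Sum>i=1..n. M.expectation (X i)) - N.expectation Y0)"
    have c_eq: "c n = a n + (\<Sum>i=1..n. M.expectation (D i)) / real n powr (1 / \<alpha>)" if "n \<ge> 1" for n
    proof -
      (* Both V and Y0 have law F; comparing their means identifies the shift a n. *)
      let ?V = "\<lambda>\<omega>. (\<Sum>i=1..n. Y i \<omega>) / real n powr (1 / \<alpha>) - a n"
      have V: "?V \<in> borel_measurable M" by measurable
      have "M.expectation ?V = (\<integral>x. x \<partial>distr M borel ?V)"
        by (subst integral_distr[OF V]) simp_all
      also have "\<dots> = N.expectation Y0"
        unfolding a[OF that] F_def using rv_Y0 by (subst integral_distr) auto
      finally have mean_V: "M.expectation ?V = N.expectation Y0" .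
      have "N.expectation Y0 = (\<Sum>i=1..n. M.expectation (Y i)) / real n powr (1 / \<alpha>) - a n"
      proof -
        have int_sum: "integrable M (\<lambda>\<omega>. \<Sum>i=1..n. Y i \<omega>)"
          by (intro Bochner_Integration.integrable_sum intY) simp
        have "M.expectation (\<lambda>\<omega>. \<Sum>i=1..n. Y i \<omega>) = (\<Sum>i=1..n. M.expectation (Y i))"
          by (intro Bochner_Integration.integral_sum intY) simp
        moreover have "M.expectation ?V = M.expectation (\<lambda>\<omega>. \<Sum>i=1..n. Y i \<omega>) / real n powr (1 / \<alpha>) - a n"
          using int_sum by (simp add: M.prob_space)
        ultimately show ?thesis using mean_V by (simp only:)
      qed
      moreover have "(\<Sum>i=1..n. M.expectation (D i)) = (\<Sum>i=1..n. M.expectation (X i)) - (\<Sum>i=1..n. M.expectation (Y i))"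
        unfolding sum_subtractf[symmetric] using intX intY by (intro sum.cong) (auto simp: D_def)
      ultimately show ?thesis
        by (simp add: c_def powr_minus_divide diff_divide_distrib)
    qed
    have "(\<lambda>n. J n (c n)) \<longlonglongrightarrow> 0"
    proof (rule ennreal_tendsto_0_by_bounds)
      fix \<epsilon> :: real assume "\<epsilon> > 0"
      then obtain b where b: "b > 0" "8 * (4 * b) powr \<alpha> = \<epsilon>" using radius by blast
      have "J n (c n) \<le> ennreal \<epsilon> + 128 * large_jump_mean M \<alpha> b D n" if "n \<ge> 1" for n
        unfolding c_eq[OF that] b(2)[symmetric] using intD
        by (intro order_trans[OF J_le[OF that]] M.normalised_sum_bound_gt_1 alpha1 alpha that b indD) auto
      then show "\<exists>L. L \<longlonglongrightarrow> 0 \<and> (\<forall>n\<ge>1. J n (c n) \<le> ennreal \<epsilon> + 128 * L n)"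
        using L[OF b(1)] by blast
    qed simp
    then have lim: "(\<lambda>n. mallows_dist \<alpha> (distr M borel (\<lambda>\<omega>. S n \<omega> - c n)) (distr N borel Y0)) \<longlonglongrightarrow> 0"
      unfolding mallows using alpha by (intro ennreal_powr_tendsto_0) auto
    show ?thesis
      by (intro conjI impI allI exI[of _ c]) (rule lim intY0 lim[unfolded c_def] | erule intX)+
  qed
qed

end
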